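(* Let $A$ and $B$ be unital C$^*$-algebras and let $\omega: A\times B\to\mathbb{C}$ be a bilinear functional that is positive on pure tensors (i.e. $\omega(a,b)\ge 0$ whenever $a\in A$, $b\in B$ are positive) and satisfies $\omega(1,1)=1$. Then there exist a Hilbert space $H$, a state $\rho$ on $B(H)$, and positive unital linear maps $\nu_A: A\to B(H)$ and $\nu_B: B\to B(H)$ such that every element of $\nu_A(A)$ commutes with every element of $\nu_B(B)$, and $$\omega(a,b)=\rho\big(\nu_A(a)\,\nu_B(b)\big)\qquad\text{for all } a\in A,\ b\in B.$$ In particular $\nu_A$ maps $A^{+,1}_{sa}$ into $B(H)^{+,1}_{sa}$ and $\nu_B$ maps $B^{+,1}_{sa}$ into $B(H)^{+,1}_{sa}$, and both carry measurement systems to measurement systems.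
   Context: For a unital C$^*$-algebra $C$, $C^{+,1}_{sa}=\{x\in C: 0\le x\le 1\}$. A measurement system (POVM) in $C$ is a finite family $\{Q_a\}_{a=1}^N\subset C^{+,1}_{sa}$ with $\sum_a Q_a=1$. A state on $B(H)$ is a positive linear functional of norm $1$. (Physically, every non-signalling, locally quantum preparation of a bipartite system whose local observables are described by $A$ and $B$ corresponds to such an $\omega$, via $p(a,b|x,y)=\omega(Q^x_a,R^y_b)$.) *)

theory Defs
  imports "HOL-Analysis.Infinite_Sum" "HOL-Library.Complex_Order" "HOL-Library.Function_Algebras"
begin

class cstar_algebra_1 = real_normed_algebra_1 + banach +
  fixes scaleC :: "complex \<Rightarrow> 'a \<Rightarrow> 'a"
    and cstar :: "'a \<Rightarrow> 'a"
  assumes scaleC_add_right: "scaleC c (x + y) = scaleC c x + scaleC c y"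
    and scaleC_add_left: "scaleC (c + d) x = scaleC c x + scaleC d x"
    and scaleC_scaleC: "scaleC c (scaleC d x) = scaleC (c * d) x"
    and scaleC_one: "scaleC 1 x = x"
    and scaleR_scaleC: "scaleR r x = scaleC (complex_of_real r) x"
    and norm_scaleC: "norm (scaleC c x) = cmod c * norm x"
    and mult_scaleC_left: "scaleC c x * y = scaleC c (x * y)"
    and mult_scaleC_right: "x * scaleC c y = scaleC c (x * y)"
    and cstar_cstar: "cstar (cstar x) = x"
    and cstar_add: "cstar (x + y) = cstar x + cstar y"
    and cstar_mult: "cstar (x * y) = cstar y * cstar x"
    and cstar_scaleC: "cstar (scaleC c x) = scaleC (cnj c) (cstar x)"
    and cstar_identity: "norm (cstar x * x) = (norm x)\<^sup>2"

definition cinvertible :: "'a::cstar_algebra_1 \<Rightarrow> bool" where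
  "cinvertible x \<longleftrightarrow> (\<exists>y. x * y = 1 \<and> y * x = 1)"

definition cpos :: "'a::cstar_algebra_1 \<Rightarrow> bool" where
  "cpos a \<longleftrightarrow> cstar a = a \<and>
     (\<forall>z::complex. (Im z \<noteq> 0 \<or> Re z < 0) \<longrightarrow> cinvertible (a - scaleC z 1))"

definition ceffects :: "'a::cstar_algebra_1 set" where
  "ceffects = {x. cpos x \<and> cpos (1 - x)}"

definition cpovm :: "nat \<Rightarrow> (nat \<Rightarrow> 'a::cstar_algebra_1) \<Rightarrow> bool" where
  "cpovm N Q \<longleftrightarrow> (\<forall>a\<in>{1..N}. Q a \<in> ceffects) \<and> (\<Sum>a\<in>{1..N}. Q a) = 1"

text \<open>Every Hilbert space is unitarily equivalent to l2(I) for an index set I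
(the cardinality of an orthonormal basis).\<close>

definition l2 :: "'i set \<Rightarrow> ('i \<Rightarrow> complex) set" where
  "l2 I = {x. (\<forall>i. i \<notin> I \<longrightarrow> x i = 0) \<and> (\<lambda>i. (cmod (x i))\<^sup>2) summable_on I}"

definition l2_inner :: "'i set \<Rightarrow> ('i \<Rightarrow> complex) \<Rightarrow> ('i \<Rightarrow> complex) \<Rightarrow> complex" where
  "l2_inner I x y = infsum (\<lambda>i. cnj (x i) * y i) I"

definition l2_norm :: "'i set \<Rightarrow> ('i \<Rightarrow> complex) \<Rightarrow> real" where
  "l2_norm I x = sqrt (infsum (\<lambda>i. (cmod (x i))\<^sup>2) I)"

type_synonym 'i op = "('i \<Rightarrow> complex) \<Rightarrow> ('i \<Rightarrow> complex)"

text \<open>B(H): bounded linear operators on l2(I); represented extensionally (zero off l2(I)).\<close>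
definition bop :: "'i set \<Rightarrow> 'i op set" where
  "bop I = {T. (\<forall>x\<in>l2 I. T x \<in> l2 I) \<and> (\<forall>x. x \<notin> l2 I \<longrightarrow> T x = (\<lambda>_. 0))
      \<and> (\<forall>x\<in>l2 I. \<forall>y\<in>l2 I. T (\<lambda>i. x i + y i) = (\<lambda>i. T x i + T y i))
      \<and> (\<forall>x\<in>l2 I. \<forall>c. T (\<lambda>i. c * x i) = (\<lambda>i. c * T x i))
      \<and> (\<exists>K. \<forall>x\<in>l2 I. l2_norm I (T x) \<le> K * l2_norm I x)}"

definition op_id :: "'i set \<Rightarrow> 'i op" where
  "op_id I = (\<lambda>x. if x \<in> l2 I then x else (\<lambda>_. 0))"

definition op_scale :: "complex \<Rightarrow> 'i op \<Rightarrow> 'i op" where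
  "op_scale c T = (\<lambda>x i. c * T x i)"

definition op_norm :: "'i set \<Rightarrow> 'i op \<Rightarrow> real" where
  "op_norm I T = (SUP x\<in>{x\<in>l2 I. l2_norm I x \<le> 1}. l2_norm I (T x))"

definition op_pos :: "'i set \<Rightarrow> 'i op \<Rightarrow> bool" where
  "op_pos I T \<longleftrightarrow> T \<in> bop I \<and> (\<forall>x\<in>l2 I. l2_inner I x (T x) \<ge> 0)"

definition op_effects :: "'i set \<Rightarrow> 'i op set" where
  "op_effects I = {T. op_pos I T \<and> op_pos I (op_id I - T)}"

definition op_povm :: "'i set \<Rightarrow> nat \<Rightarrow> (nat \<Rightarrow> 'i op) \<Rightarrow> bool" where
  "op_povm I N Q \<longleftrightarrow> (\<forall>a\<in>{1..N}. Q a \<in> op_effects I) \<and> (\<Sum>a\<in>{1..N}. Q a) = op_id I"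

definition bh_state :: "'i set \<Rightarrow> ('i op \<Rightarrow> complex) \<Rightarrow> bool" where
  "bh_state I \<rho> \<longleftrightarrow>
     (\<forall>S\<in>bop I. \<forall>T\<in>bop I. \<rho> (S + T) = \<rho> S + \<rho> T)
   \<and> (\<forall>T\<in>bop I. \<forall>c. \<rho> (op_scale c T) = c * \<rho> T)
   \<and> (\<forall>T\<in>bop I. op_pos I T \<longrightarrow> \<rho> T \<ge> 0)
   \<and> (SUP T\<in>{T\<in>bop I. op_norm I T \<le> 1}. cmod (\<rho> T)) = 1"

definition pos_unital_map :: "'i set \<Rightarrow> ('a::cstar_algebra_1 \<Rightarrow> 'i op) \<Rightarrow> bool" where
  "pos_unital_map I \<nu> \<longleftrightarrow>
     (\<forall>a. \<nu> a \<in> bop I)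
   \<and> (\<forall>a b. \<nu> (a + b) = \<nu> a + \<nu> b)
   \<and> (\<forall>c a. \<nu> (scaleC c a) = op_scale c (\<nu> a))
   \<and> (\<forall>a. cpos a \<longrightarrow> op_pos I (\<nu> a))
   \<and> \<nu> 1 = op_id I"

definition bilinear_functional :: "('a::cstar_algebra_1 \<Rightarrow> 'b::cstar_algebra_1 \<Rightarrow> complex) \<Rightarrow> bool" where
  "bilinear_functional \<omega> \<longleftrightarrow>
     (\<forall>a a' b. \<omega> (a + a') b = \<omega> a b + \<omega> a' b)
   \<and> (\<forall>a b b'. \<omega> a (b + b') = \<omega> a b + \<omega> a b')
   \<and> (\<forall>c a b. \<omega> (scaleC c a) b = c * \<omega> a b)
   \<and> (\<forall>c a b. \<omega> a (scaleC c b) = c * \<omega> a b)"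

end

theory Submission
  imports Defs
begin

text \<open>Apply the GNS construction to the functional \<open>a \<mapsto> \<omega> a 1\<close>. Then \<open>\<nu>A\<close> is the representation
  by left multiplication, \<open>\<nu>B b\<close> is the Radon--Nikodym derivative of \<open>a \<mapsto> \<omega> a b\<close>, which lies in
  the commutant of the representation, and \<open>\<rho>\<close> is the vector state of the cyclic vector.
  The GNS inner product is positive because \<open>cstar x * x\<close> has positive spectrum (Kelley--Vaught).
  Instead of completing the quotient of \<open>A\<close>, a transfinite Gram--Schmidt process provides the
  coordinates of its elements in an orthonormal basis of the completion; the basis is indexed
  through the surjection \<open>fst\<close> from \<open>A \<times> B\<close> onto \<open>A\<close>.\<close>

section \<open>Positive elements of a unital C*-algebra\<close>

text \<open>Positivity is defined through the spectrum, which makes neither sums nor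
  \<open>cstar x * x\<close> visibly positive. The norm cone \<open>ccone\<close> is evidently
  closed under sums, and its elements have square roots obtained from a norm-convergent iteration;
  spectral questions then reduce to factoring invertible elements, and the two cones turn out to
  coincide. The two algebras are treated asymmetrically because \<omega> is positive on pure tensors
  only: on sums of products of both algebras no inner product is available. Multiplying in A alone
  keeps every square inside A, where pairing with a fixed positive b still gives a positive
  functional. Hence \<nu>A acts by multiplication while \<nu>B is merely positive. Commutation is
  then associativity: in \<open>\<omega> (cstar x * y) b\<close> a factor a moves from one vector to
  the other as \<open>cstar a\<close>. Since \<omega> carries no continuity hypothesis, all operator
  bounds are extracted from the positivity of \<open>norm h - h\<close> for hermitian h.\<close>

lemma scaleC_of_real: "scaleC (complex_of_real r) x = r *\<^sub>R x"
  by (simp add: scaleR_scaleC)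

lemma scaleC_of_real_1 [simp]: "scaleC (complex_of_real r) (1::'a::cstar_algebra_1) = of_real r"
  by (simp add: scaleC_of_real of_real_def[where 'a = 'a])

lemma scaleC_0_left [simp]: "scaleC 0 x = 0"
  using scaleC_of_real[of 0 x] by simp

lemma scaleC_0_right [simp]: "scaleC c 0 = 0"
  using scaleC_add_right[of c 0 0] by simp

lemma scaleC_minus_left: "scaleC (- c) x = - scaleC c x"
  using scaleC_add_left[of c "- c" x] by (simp add: eq_neg_iff_add_eq_0 add.commute)

lemma scaleC_minus_right: "scaleC c (- x) = - scaleC c x"
  using scaleC_add_right[of c x "- x"] by (simp add: eq_neg_iff_add_eq_0 add.commute)

lemma scaleC_diff_right: "scaleC c (x - y) = scaleC c x - scaleC c y"
  using scaleC_add_right[of c x "- y"] by (simp add: scaleC_minus_right)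

lemma cstar_0 [simp]: "cstar (0::'a::cstar_algebra_1) = 0"
  using cstar_add[of "0::'a" 0] by simp

lemma cstar_minus: "cstar (- x) = - cstar (x::'a::cstar_algebra_1)"
  using cstar_add[of x "- x"] by (simp add: eq_neg_iff_add_eq_0 add.commute)

lemma cstar_diff: "cstar (x - y) = cstar x - cstar (y::'a::cstar_algebra_1)"
  using cstar_add[of x "- y"] by (simp add: cstar_minus)

lemma cstar_1 [simp]: "cstar (1::'a::cstar_algebra_1) = 1"
  using cstar_mult[of "cstar 1" "1::'a"] by (simp add: cstar_cstar)

lemma cstar_scaleR: "cstar (r *\<^sub>R x) = r *\<^sub>R cstar (x::'a::cstar_algebra_1)"
  by (simp add: scaleR_scaleC cstar_scaleC)

lemma cstar_of_real [simp]: "cstar (of_real r) = (of_real r :: 'a::cstar_algebra_1)"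
  by (simp add: of_real_def cstar_scaleR)

lemma norm_cstar [simp]: "norm (cstar x) = norm (x::'a::cstar_algebra_1)"
proof -
  have le: "norm y \<le> norm (cstar y)" for y :: 'a
  proof (cases "y = 0")
    case False
    have "norm y * norm y \<le> norm (cstar y) * norm y"
      using norm_mult_ineq[of "cstar y" y] by (simp add: cstar_identity power2_eq_square)
    then show ?thesis using False by simp
  qed simp
  show ?thesis using le[of x] le[of "cstar x"] by (simp add: cstar_cstar)
qed

lemma bounded_linear_cstar: "bounded_linear (cstar :: 'a::cstar_algebra_1 \<Rightarrow> 'a)"
  by (rule bounded_linear_intro[where K = 1]) (simp_all add: cstar_add cstar_scaleR)

lemma norm_square_hermitian:
  "cstar h = h \<Longrightarrow> norm (h * h) = (norm (h::'a::cstar_algebra_1))\<^sup>2"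
  using cstar_identity[of h] by simp

section \<open>Invertible elements and the spectrum\<close>

lemma cinvertible_scaleR:
  assumes "cinvertible x" "r \<noteq> 0"
  shows "cinvertible (r *\<^sub>R x)"
proof -
  obtain y where "x * y = 1" "y * x = 1" using assms(1) by (auto simp: cinvertible_def)
  then show ?thesis using assms(2) unfolding cinvertible_def
    by (intro exI[of _ "inverse r *\<^sub>R y"]) simp
qed

lemma cinvertible_minus: "cinvertible x \<Longrightarrow> cinvertible (- x)"
  using cinvertible_scaleR[of x "- 1"] by simp

lemma cinvertible_mult:
  assumes "cinvertible x" "cinvertible y"
  shows "cinvertible (x * y)"
proof -
  obtain x' y' where "x * x' = 1" "x' * x = 1" "y * y' = 1" "y' * y = 1"
    using assms by (auto simp: cinvertible_def)
  then have "(x * y) * (y' * x') = 1 \<and> (y' * x') * (x * y) = 1"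
    by (metis mult.assoc mult_1_right)
  then show ?thesis unfolding cinvertible_def by blast
qed

text \<open>Commutation turns the inverse of the product into a right inverse and a left inverse of
  \<open>x\<close>, and these must agree. It replaces spectral mapping in the later
  factorisations.\<close>

lemma cinvertible_factor:
  assumes "x * y = y * x" "cinvertible (x * y)"
  shows "cinvertible x"
proof -
  obtain w where w: "(x * y) * w = 1" "w * (x * y) = 1"
    using assms(2) by (auto simp: cinvertible_def)
  have 1: "x * (y * w) = 1" using w(1) by (simp add: mult.assoc)
  have 2: "(w * y) * x = 1" using w(2) assms(1) by (simp add: mult.assoc)
  have "w * y = y * w" using 1 2 by (metis mult.assoc mult_1_left mult_1_right)
  then show ?thesis using 1 2 unfolding cinvertible_def by auto
qed

text \<open>Jacobson's lemma: expanding the geometric series formally suggests the inverse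
  \<open>1 + y * w * x\<close>. It means that \<open>x * y\<close> and \<open>y * x\<close> have the
  same nonzero spectrum.\<close>

lemma cinvertible_one_minus_swap:
  fixes x y :: "'a::cstar_algebra_1"
  assumes "cinvertible (1 - x * y)"
  shows "cinvertible (1 - y * x)"
proof -
  obtain w where w: "(1 - x * y) * w = 1" "w * (1 - x * y) = 1"
    using assms by (auto simp: cinvertible_def)
  have 1: "x * y * w = w - 1" "w * x * y = w - 1"
    using w by (auto simp: algebra_simps)
  have "(1 - y * x) * (1 + y * w * x) = 1 - y * x + y * w * x - y * (x * y * w) * x"
    by (simp add: algebra_simps)
  also have "\<dots> = 1" by (simp only: 1) (simp add: algebra_simps)
  finally have 2: "(1 - y * x) * (1 + y * w * x) = 1" .
  have "(1 + y * w * x) * (1 - y * x) = 1 - y * x + y * w * x - y * (w * x * y) * x"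
    by (simp add: algebra_simps)
  also have "\<dots> = 1" by (simp only: 1) (simp add: algebra_simps)
  finally have 3: "(1 + y * w * x) * (1 - y * x) = 1" .
  show ?thesis using 2 3 unfolding cinvertible_def by blast
qed

text \<open>Neumann series; completeness of the algebra enters here.\<close>

lemma cinvertible_one_minus:
  fixes x :: "'a::cstar_algebra_1"
  assumes "norm x < 1"
  shows "cinvertible (1 - x)"
proof -
  define s where "s = (\<Sum>n. x ^ n)"
  have sm: "summable (\<lambda>n. x ^ n)" by (rule complete_algebra_summable_geometric[OF assms])
  then have ss: "(\<lambda>n. x ^ n) sums s" unfolding s_def by (rule summable_sums)
  have 0: "(\<lambda>n. x ^ Suc n) sums (s - 1)" using ss sums_Suc_iff[of "\<lambda>n. x ^ n"] by simp
  have "x * s = s - 1"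
    using sums_unique2[OF sums_mult[OF ss, of x]] 0 by simp
  moreover have "s * x = s - 1"
    using sums_unique2[OF sums_mult2[OF ss, of x]] 0 by (simp add: power_commutes)
  ultimately show ?thesis unfolding cinvertible_def
    by (intro exI[of _ s]) (simp add: algebra_simps)
qed

lemma cinvertible_scaleC:
  fixes x :: "'a::cstar_algebra_1"
  assumes "cinvertible x" "c \<noteq> 0"
  shows "cinvertible (scaleC c x)"
proof -
  obtain y where "x * y = 1" "y * x = 1" using assms(1) by (auto simp: cinvertible_def)
  then show ?thesis using assms(2) unfolding cinvertible_def
    by (intro exI[of _ "scaleC (inverse c) y"])
      (simp add: mult_scaleC_left mult_scaleC_right scaleC_scaleC scaleC_one)
qed

lemma cinvertible_diff_scaleC:
  fixes x :: "'a::cstar_algebra_1"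
  assumes "norm x < cmod z"
  shows "cinvertible (x - scaleC z 1)"
proof -
  have z: "z \<noteq> 0" using assms by auto
  have "norm (scaleC (inverse z) x) = norm x / cmod z"
    by (simp add: norm_scaleC norm_inverse divide_inverse mult.commute)
  also have "\<dots> < 1" using assms z by simp
  finally have "norm (scaleC (inverse z) x) < 1" .
  then have "cinvertible (scaleC (- z) (1 - scaleC (inverse z) x))"
    using z by (intro cinvertible_scaleC cinvertible_one_minus) auto
  also have "scaleC (- z) (1 - scaleC (inverse z) x) = x - scaleC z 1"
    using z by (simp add: scaleC_diff_right scaleC_scaleC scaleC_minus_left scaleC_one)
  finally show ?thesis .
qed

lemma cinvertible_of_real_diff:
  fixes x :: "'a::cstar_algebra_1"
  assumes "norm x < t"
  shows "cinvertible (of_real t - x)"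
  using cinvertible_minus[OF cinvertible_diff_scaleC[of x "complex_of_real t"]] assms
  by simp

text \<open>Translating along the imaginary axis by \<open>r\<close> moves the point \<open>z\<close> out of the disc of
  radius \<open>norm (a + i r)\<close> once \<open>r\<close> is large, because
  \<open>(norm (a + i r))\<^sup>2 \<le> (norm a)\<^sup>2 + r\<^sup>2\<close> for hermitian \<open>a\<close>.\<close>

lemma hermitian_spectrum_real:
  fixes a :: "'a::cstar_algebra_1"
  assumes a: "cstar a = a" and z: "Im z \<noteq> 0"
  shows "cinvertible (a - scaleC z 1)"
proof -
  \<comment> \<open>With this value the cross term \<open>2 * Im z * r\<close> of the square of
    \<open>Im z + r\<close> equals the square of \<open>norm a\<close>, so the strict excess is the
    square of \<open>Im z\<close>.\<close>
  define r where "r = (norm a)\<^sup>2 / (2 * Im z)"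
  define x where "x = a + scaleC (\<i> * complex_of_real r) 1"
  have cx: "cstar x = a - scaleC (\<i> * complex_of_real r) 1"
    by (simp add: x_def cstar_add cstar_scaleC a scaleC_minus_left)
  have "cstar x * x = a * a - scaleC ((\<i> * complex_of_real r) * (\<i> * complex_of_real r)) 1"
    unfolding cx
    by (simp add: x_def algebra_simps mult_scaleC_left mult_scaleC_right scaleC_scaleC
        scaleC_diff_right)
  also have "(\<i> * complex_of_real r) * (\<i> * complex_of_real r) = complex_of_real (- (r\<^sup>2))"
    by (simp add: complex_eq_iff power2_eq_square)
  finally have "cstar x * x = a * a + of_real (r\<^sup>2)"
    unfolding scaleC_of_real_1 by simp
  then have "(norm x)\<^sup>2 = norm (a * a + of_real (r\<^sup>2))" using cstar_identity[of x] by simp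
  also have "\<dots> \<le> (norm a)\<^sup>2 + r\<^sup>2"
    using norm_triangle_ineq[of "a * a" "of_real (r\<^sup>2)"]
    unfolding norm_of_real norm_square_hermitian[OF a] by simp
  also have "\<dots> < (Re z)\<^sup>2 + (Im z + r)\<^sup>2"
  proof -
    have "(Im z + r)\<^sup>2 = (Im z)\<^sup>2 + (norm a)\<^sup>2 + r\<^sup>2"
      using z by (simp add: r_def power2_sum)
    moreover have "0 < (Im z)\<^sup>2" using z by simp
    moreover have "0 \<le> (Re z)\<^sup>2" by simp
    ultimately show ?thesis by linarith
  qed
  also have "\<dots> = (cmod (z + \<i> * complex_of_real r))\<^sup>2" by (simp add: cmod_power2)
  finally have "norm x < cmod (z + \<i> * complex_of_real r)" by (rule power_less_imp_less_base) simp
  then have "cinvertible (x - scaleC (z + \<i> * complex_of_real r) 1)"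
    by (rule cinvertible_diff_scaleC)
  then show ?thesis by (simp add: x_def scaleC_add_left)
qed

text \<open>The square root \<open>1 - y\<close> of \<open>1 - c\<close> is found from the fixed point equation
  \<open>y = (c + y\<^sup>2) / 2\<close>; the iterates are dominated by the ones for the real number \<open>c = 1\<close>.\<close>

lemma sqrt_one_minus:
  fixes c :: "'a::cstar_algebra_1"
  assumes c: "cstar c = c" "norm c \<le> 1"
  obtains s where "cstar s = s" "s * s = 1 - c" "norm (1 - s) \<le> 1"
    "\<And>x. x * c = c * x \<Longrightarrow> x * s = s * x"
proof -
  define y :: "nat \<Rightarrow> 'a" where "y = rec_nat 0 (\<lambda>_ v. (c + v * v) /\<^sub>R 2)"
  define r :: "nat \<Rightarrow> real" where "r = rec_nat 0 (\<lambda>_ v. (1 + v * v) / 2)"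
  have y0: "y 0 = 0" and yS: "y (Suc n) = (c + y n * y n) /\<^sub>R 2" for n by (simp_all add: y_def)
  have r0: "r 0 = 0" and rS: "r (Suc n) = (1 + r n * r n) / 2" for n by (simp_all add: r_def)
  have r01: "0 \<le> r n \<and> r n \<le> 1" for n
  proof (induction n)
    case (Suc n)
    then have "r n * r n \<le> 1" by (simp add: mult_le_one)
    then show ?case by (simp add: rS)
  qed (simp add: r0)
  have yr: "norm (y n) \<le> r n" for n
  proof (induction n)
    case (Suc n)
    have "norm (y n * y n) \<le> r n * r n"
      using norm_mult_ineq[of "y n" "y n"] mult_mono[OF Suc Suc] r01[of n] by simp
    then have "norm (c + y n * y n) \<le> 1 + r n * r n"
      using norm_triangle_ineq[of c "y n * y n"] c(2) by linarith
    then show ?case by (simp add: yS rS)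
  qed (simp add: y0 r0)
  have com: "x * y n = y n * x" if "x * c = c * x" for x n
  proof (induction n)
    case (Suc n)
    have "x * (y n * y n) = (y n * y n) * x" using Suc by (metis mult.assoc)
    then show ?case using that by (simp add: yS algebra_simps)
  qed (simp add: y0)
  have yc: "y n * c = c * y n" for n using com[of c n] by simp
  have yy: "y m * y n = y n * y m" for m n using com[OF yc] .
  have herm: "cstar (y n) = y n" for n
    by (induction n) (simp_all add: y0 yS cstar_scaleR cstar_add cstar_mult c)
  \<comment> \<open>Since the iterates commute, a difference of squares factors as sum times
    difference. The same factorisation for \<open>r\<close> shows that the increments, and not only
    the values, are dominated.\<close>
  have step: "norm (y (Suc n) - y n) \<le> r (Suc n) - r n" for n
  proof (induction n)
    case 0
    then show ?case using c by (simp add: y0 r0 yS rS)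
  next
    case (Suc n)
    have "y (Suc (Suc n)) - y (Suc n) = ((y (Suc n) + y n) * (y (Suc n) - y n)) /\<^sub>R 2"
      using yy[of "Suc n" n] by (simp only: yS[of "Suc n"] yS[of n])
        (simp add: algebra_simps flip: yS)
    then have "norm (y (Suc (Suc n)) - y (Suc n))
        \<le> norm (y (Suc n) + y n) * norm (y (Suc n) - y n) / 2"
      using norm_mult_ineq[of "y (Suc n) + y n" "y (Suc n) - y n"] by simp
    also have "\<dots> \<le> (r (Suc n) + r n) * (r (Suc n) - r n) / 2"
      using Suc yr[of n] yr[of "Suc n"] norm_triangle_ineq[of "y (Suc n)" "y n"] r01
      by (intro divide_right_mono mult_mono) (auto intro: add_nonneg_nonneg)
    also have "\<dots> = r (Suc (Suc n)) - r (Suc n)"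
      using rS[of n] unfolding rS[of "Suc n"] by (simp add: field_simps)
    finally show ?case .
  qed
  have dist: "norm (y (n + k) - y n) \<le> r (n + k) - r n" for n k
  proof (induction k)
    case (Suc k)
    show ?case using Suc step[of "n + k"]
        norm_triangle_ineq[of "y (n + Suc k) - y (n + k)" "y (n + k) - y n"] by simp
  qed simp
  \<comment> \<open>The limit of \<open>r\<close> need not be computed: monotone and bounded by 1,
    it is Cauchy, and \<open>dist\<close> transfers this to \<open>y\<close>.\<close>
  have "incseq r" using order_trans[OF norm_ge_zero step] by (intro incseq_SucI) simp
  moreover have "Bseq r" using r01 by (intro BseqI'[of _ 1]) simp
  ultimately have "convergent r" by (intro Bseq_monoseq_convergent incseq_imp_monoseq)
  then have Cr: "Cauchy r" by (rule convergent_Cauchy)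
  have "Cauchy y"
  proof (rule CauchyI')
    fix e :: real assume "0 < e"
    then obtain M where M: "\<And>m n. m \<ge> M \<Longrightarrow> n \<ge> M \<Longrightarrow> norm (r m - r n) < e"
      using CauchyD[OF Cr] by blast
    have "dist (y m) (y n) < e" if "m \<ge> M" "m < n" for m n
      using dist[of m "n - m"] M[of n m] that by (simp add: dist_norm norm_minus_commute)
    then show "\<exists>M. \<forall>m\<ge>M. \<forall>n>m. dist (y m) (y n) < e" by blast
  qed
  then obtain b where b: "y \<longlonglongrightarrow> b" using Cauchy_convergent convergentD by blast
  have "(\<lambda>n. y (Suc n)) \<longlonglongrightarrow> (c + b * b) /\<^sub>R 2"
    unfolding yS by (intro tendsto_intros b)
  then have bb: "b = (c + b * b) /\<^sub>R 2"
    by (rule LIMSEQ_unique[OF LIMSEQ_Suc[OF b]])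
  have hb: "cstar b = b"
    using bounded_linear.tendsto[OF bounded_linear_cstar b] b
    unfolding herm by (rule LIMSEQ_unique)
  have nb: "norm b \<le> 1"
    using yr r01 by (intro LIMSEQ_le_const2[OF tendsto_norm[OF b]]) (auto intro: order_trans)
  have cb: "x * b = b * x" if "x * c = c * x" for x
  proof (rule LIMSEQ_unique[of "\<lambda>n. x * y n"])
    show "(\<lambda>n. x * y n) \<longlonglongrightarrow> x * b" by (intro tendsto_intros b)
    show "(\<lambda>n. x * y n) \<longlonglongrightarrow> b * x"
      unfolding com[OF that] by (intro tendsto_intros b)
  qed
  have "2 *\<^sub>R b = c + b * b" by (subst bb) simp
  then have "(1 - b) * (1 - b) = 1 - c" by (simp add: algebra_simps scaleR_2)
  then show thesis
    by (rule that[rotated]) (use hb nb cb in \<open>simp_all add: cstar_diff left_diff_distrib right_diff_distrib\<close>)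
qed

text \<open>A description of the positive cone in terms of the norm, for which closure under sums
  is evident.\<close>

definition ccone :: "'a::cstar_algebra_1 \<Rightarrow> bool" where
  "ccone a \<longleftrightarrow> cstar a = a \<and> (\<exists>t\<ge>0. norm (of_real t - a) \<le> t)"

lemma ccone_hermitian: "ccone a \<Longrightarrow> cstar a = a"
  by (simp add: ccone_def)

lemma ccone_add:
  assumes "ccone a" "ccone b"
  shows "ccone (a + b)"
proof -
  obtain s t where "s \<ge> 0" "norm (of_real s - a) \<le> s" "t \<ge> 0" "norm (of_real t - b) \<le> t"
    using assms by (auto simp: ccone_def)
  then have "s + t \<ge> 0 \<and> norm (of_real (s + t) - (a + b)) \<le> s + t"
    using norm_triangle_ineq[of "of_real s - a" "of_real t - b"] by (simp add: algebra_simps)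
  then show ?thesis using assms unfolding ccone_def cstar_add by metis
qed

lemma ccone_scaleR:
  assumes "ccone a" "r \<ge> 0"
  shows "ccone (r *\<^sub>R a)"
proof -
  obtain t where "t \<ge> 0" "norm (of_real t - a) \<le> t" using assms by (auto simp: ccone_def)
  moreover have "of_real (r * t) - r *\<^sub>R a = r *\<^sub>R (of_real t - a)"
    by (simp add: of_real_def scaleR_right_diff_distrib)
  ultimately have "r * t \<ge> 0 \<and> norm (of_real (r * t) - r *\<^sub>R a) \<le> r * t"
    using assms(2) by (simp add: mult_left_mono)
  then show ?thesis using assms unfolding ccone_def cstar_scaleR by metis
qed

text \<open>For real \<open>z < 0\<close> write \<open>a - z\<close> as
  \<open>(t - z) - (t - a)\<close>: the scalar exceeds \<open>t\<close>, hence the norm of the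
  second term, and the Neumann series applies.\<close>

lemma ccone_imp_cpos:
  fixes a :: "'a::cstar_algebra_1"
  assumes "ccone a"
  shows "cpos a"
  unfolding cpos_def
proof (intro conjI allI impI)
  show h: "cstar a = a" using assms by (rule ccone_hermitian)
  fix z :: complex assume z: "Im z \<noteq> 0 \<or> Re z < 0"
  show "cinvertible (a - scaleC z 1)"
  proof (cases "Im z = 0")
    case True
    then have zr: "z = complex_of_real (Re z)" "Re z < 0" using z by (auto simp: complex_eq_iff)
    obtain t where t: "t \<ge> 0" "norm (of_real t - a) \<le> t" using assms by (auto simp: ccone_def)
    have "cinvertible (of_real (t - Re z) - (of_real t - a))"
      using t zr by (intro cinvertible_of_real_diff) auto
    also have "of_real (t - Re z) - (of_real t - a) = a - scaleC z 1"
      by (subst (2) zr(1)) (simp only: scaleC_of_real_1, simp)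
    finally show ?thesis .
  qed (simp add: h hermitian_spectrum_real)
qed

lemma cpos_cinvertible:
  assumes "cpos a" "t > 0"
  shows "cinvertible (of_real t + a)"
proof -
  have "cinvertible (a - scaleC (complex_of_real (- t)) 1)"
    using assms unfolding cpos_def by simp
  then show ?thesis unfolding scaleC_of_real_1 by (simp add: add.commute)
qed

text \<open>The spectrum of a hermitian element is real, so only negative real points remain to be
  excluded.\<close>

lemma cposI:
  fixes a :: "'a::cstar_algebra_1"
  assumes "cstar a = a" "\<And>t. t > 0 \<Longrightarrow> cinvertible (of_real t + a)"
  shows "cpos a"
  unfolding cpos_def
proof (intro conjI allI impI)
  fix z :: complex assume z: "Im z \<noteq> 0 \<or> Re z < 0"
  show "cinvertible (a - scaleC z 1)"
  proof (cases "Im z = 0")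
    case True
    then have zr: "z = complex_of_real (Re z)" "Re z < 0" using z by (auto simp: complex_eq_iff)
    show ?thesis using assms(2)[of "- Re z"] zr(2)
      by (subst zr(1)) (simp only: scaleC_of_real_1, simp)
  qed (simp add: assms hermitian_spectrum_real)
qed (fact assms)

text \<open>The element \<open>r + i s\<close> is \<open>sqrt k\<close> times a unitary.\<close>

lemma norm_le_of_sum_squares:
  fixes r s :: "'a::cstar_algebra_1"
  assumes h: "cstar r = r" "cstar s = s" "r * s = s * r" and k: "r * r + s * s = of_real k" "k \<ge> 0"
  shows "(norm r)\<^sup>2 \<le> k"
proof -
  define u where "u = r + scaleC \<i> s"
  have cu: "cstar u = r - scaleC \<i> s"
    by (simp add: u_def cstar_add cstar_scaleC h scaleC_minus_left)
  have "cstar u * u = r * r + scaleC \<i> (r * s) - scaleC \<i> (s * r) - scaleC (\<i> * \<i>) (s * s)"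
    unfolding cu
    by (simp add: u_def algebra_simps mult_scaleC_left mult_scaleC_right scaleC_scaleC
        scaleC_diff_right)
  also have "\<dots> = of_real k" using k(1) by (simp add: h scaleC_minus_left scaleC_one)
  finally have "cstar u * u = of_real k" .
  then have u: "(norm u)\<^sup>2 = k" using cstar_identity[of u] k(2) by simp
  have "2 *\<^sub>R r = u + cstar u" unfolding cu by (simp add: u_def scaleR_2)
  then have "2 * norm r \<le> 2 * norm u"
    using norm_triangle_ineq[of u "cstar u"] by (metis norm_cstar norm_scaleR mult_2 abs_numeral)
  then show ?thesis using u by (smt (verit) norm_ge_zero power_mono)
qed

text \<open>After scaling \<open>h\<close> to norm 1, the root \<open>s\<close> of
  \<open>1 - c\<close> satisfies \<open>s * s + c = 1\<close>, so it is a contraction by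
  \<open>norm_le_of_sum_squares\<close>. Then \<open>1 - c = s * s\<close> is one too, which is the
  cone condition with \<open>t\<close> the squared norm of \<open>h\<close>.\<close>

lemma ccone_square:
  fixes h :: "'a::cstar_algebra_1"
  assumes h: "cstar h = h"
  shows "ccone (h * h)"
proof (cases "h = 0")
  case True
  then show ?thesis by (auto simp: ccone_def intro: exI[of _ 0])
next
  case False
  define k where "k = (norm h)\<^sup>2"
  have k: "k > 0" using False by (simp add: k_def)
  define c where "c = (h * h) /\<^sub>R k"
  have c: "cstar c = c" "norm c \<le> 1"
    using k by (simp_all add: c_def cstar_scaleR cstar_mult h norm_square_hermitian k_def)
  obtain s where s: "cstar s = s" "s * s = 1 - c" "\<And>x. x * c = c * x \<Longrightarrow> x * s = s * x"
    using sqrt_one_minus[OF c] by metis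
  have "h * s = s * h" by (rule s(3)) (simp add: c_def mult.assoc)
  moreover have "s * s + (h /\<^sub>R norm h) * (h /\<^sub>R norm h) = of_real 1"
    by (simp add: s(2) c_def k_def power2_eq_square)
  ultimately have "(norm s)\<^sup>2 \<le> 1"
    by (intro norm_le_of_sum_squares[of s "h /\<^sub>R norm h"]) (simp_all add: s(1) h cstar_scaleR)
  then have "norm (1 - c) \<le> 1" using norm_square_hermitian[OF s(1)] by (simp add: s(2))
  moreover have "of_real k - h * h = k *\<^sub>R (1 - c)"
    using k by (simp add: c_def of_real_def scaleR_right_diff_distrib)
  ultimately have "norm (of_real k - h * h) \<le> k" using k by simp
  then show ?thesis unfolding ccone_def using k h by (auto simp: cstar_mult intro!: exI[of _ k])
qed

text \<open>The witness \<open>t\<close> of the cone makes \<open>c = 1 - a / t\<close> a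
  contraction, so \<open>sqrt_one_minus\<close> takes the root of \<open>1 - c = a / t\<close>. The
  root lies in the cone because its distance from 1 is at most 1.\<close>

lemma ccone_sqrt:
  fixes a :: "'a::cstar_algebra_1"
  assumes a: "ccone a"
  obtains s where "ccone s" "s * s = a" "\<And>x. x * a = a * x \<Longrightarrow> x * s = s * x"
proof -
  obtain t where t: "t \<ge> 0" "norm (of_real t - a) \<le> t" using a by (auto simp: ccone_def)
  have h: "cstar a = a" using a by (rule ccone_hermitian)
  show thesis
  proof (cases "t = 0")
    case True
    then have "a = 0" using t by simp
    then show thesis using a by (intro that[of 0]) auto
  next
    case False
    define c where "c = 1 - a /\<^sub>R t"
    have "t *\<^sub>R c = of_real t - a"
      using False by (simp add: c_def of_real_def scaleR_right_diff_distrib)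
    then have "t * norm c \<le> t" using t by (metis norm_scaleR abs_of_nonneg)
    then have c: "cstar c = c" "norm c \<le> 1"
      using False t(1) by (simp_all add: c_def cstar_diff cstar_scaleR h)
    obtain s where s: "cstar s = s" "s * s = 1 - c" "norm (1 - s) \<le> 1"
        "\<And>x. x * c = c * x \<Longrightarrow> x * s = s * x"
      using sqrt_one_minus[OF c] by metis
    show thesis
    proof (rule that[of "sqrt t *\<^sub>R s"])
      have "ccone s" unfolding ccone_def using s(1-3) by (auto intro!: exI[of _ 1])
      then show "ccone (sqrt t *\<^sub>R s)" using t(1) by (intro ccone_scaleR) auto
      show "(sqrt t *\<^sub>R s) * (sqrt t *\<^sub>R s) = a"
        using t(1) False by (simp add: s(2) c_def flip: mult.assoc)
      show "x * (sqrt t *\<^sub>R s) = (sqrt t *\<^sub>R s) * x" if "x * a = a * x" for x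
        using s(4)[of x] that by (simp add: c_def algebra_simps)
    qed
  qed
qed

text \<open>If \<open>w\<^sup>2 = k - r\<^sup>2\<close> is invertible, then \<open>w\<^sup>2 \<ge> 1 / m\<close> for some \<open>m\<close>,
  which lowers the bound \<open>k\<close> on \<open>r\<^sup>2\<close>.\<close>

lemma hermitian_norm_in_spectrum:
  fixes r :: "'a::cstar_algebra_1"
  assumes h: "cstar r = r" and inv: "cinvertible (of_real ((norm r)\<^sup>2) - r * r)"
  shows "r = 0"
proof (rule ccontr)
  assume "r \<noteq> 0"
  define k where "k = (norm r)\<^sup>2"
  have k: "k > 0" using \<open>r \<noteq> 0\<close> by (simp add: k_def)
  have "norm (of_real k - (of_real k - r * r)) \<le> k"
    by (simp add: norm_square_hermitian[OF h] k_def)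
  then have "ccone (of_real k - r * r)"
    unfolding ccone_def using k h by (auto simp: cstar_diff cstar_mult intro!: exI[of _ k])
  then obtain w where w: "ccone w" "w * w = of_real k - r * r"
      "\<And>x. x * (of_real k - r * r) = (of_real k - r * r) * x \<Longrightarrow> x * w = w * x"
    using ccone_sqrt by metis
  have rw: "r * w = w * r" by (rule w(3)) (simp add: algebra_simps of_real_def)
  have hw: "cstar w = w" using w(1) by (rule ccone_hermitian)
  have "cinvertible w" using cinvertible_factor[of w w] inv w(2) by (simp add: k_def)
  then obtain p where p: "w * p = 1" "p * w = 1" by (auto simp: cinvertible_def)
  have "w * cstar p = 1" using arg_cong[OF p(2), of cstar] by (simp add: cstar_mult hw)
  then have hp: "cstar p = p" using p by (metis mult.assoc mult_1_left mult_1_right)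
  have rp: "r * p = p * r" using p rw by (metis mult.assoc mult_1_left mult_1_right)
  \<comment> \<open>The squared norm of \<open>p\<close> makes \<open>c\<close> below a contraction.
    Adding \<open>1 / k\<close> ensures \<open>m > 0\<close> and \<open>1 / m \<le> k\<close>, so
    that the improved bound \<open>k - 1 / m\<close> is nonnegative.\<close>
  define m where "m = (norm p)\<^sup>2 + 1 / k"
  have m: "m > 0" "1 / m \<le> k" "(norm p)\<^sup>2 \<le> m"
  proof -
    show "m > 0" using k by (simp add: m_def add_nonneg_pos)
    have "1 / k \<le> m" by (simp add: m_def)
    then show "1 / m \<le> k" using k \<open>m > 0\<close> by (simp add: field_simps)
    show "(norm p)\<^sup>2 \<le> m" using k by (simp add: m_def)
  qed
  define c where "c = (p * p) /\<^sub>R m"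
  have c: "cstar c = c" "norm c \<le> 1"
    using m by (simp_all add: c_def cstar_scaleR cstar_mult hp norm_square_hermitian field_simps)
  \<comment> \<open>As \<open>p\<close> inverts \<open>w\<close>, the factor \<open>v\<close> lowers
    the square of \<open>w\<close> by exactly \<open>1 / m\<close>.\<close>
  obtain v where v: "cstar v = v" "v * v = 1 - c" "\<And>x. x * c = c * x \<Longrightarrow> x * v = v * x"
    using sqrt_one_minus[OF c] by metis
  have rv: "r * v = v * r" using rp by (intro v(3)) (simp add: c_def, metis mult.assoc)
  have wv: "w * v = v * w" using p by (intro v(3)) (simp add: c_def, metis mult.assoc mult_1_left mult_1_right)
  have "(w * v) * (w * v) = (w * w) * (v * v)" using wv by (metis mult.assoc)
  also have "\<dots> = w * w - (w * (w * p) * p) /\<^sub>R m" by (simp add: v(2) c_def algebra_simps)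
  also have "\<dots> = of_real k - r * r - of_real (1 / m)"
    unfolding p by (simp add: p w(2) of_real_def divide_inverse)
  finally have "r * r + (w * v) * (w * v) = of_real (k - 1 / m)" by (simp add: algebra_simps)
  moreover have "cstar (w * v) = w * v" by (simp add: cstar_mult v hw wv)
  moreover have "r * (w * v) = (w * v) * r" using rw rv by (metis mult.assoc)
  ultimately have "(norm r)\<^sup>2 \<le> k - 1 / m" using m h by (intro norm_le_of_sum_squares) auto
  then show False using m(1) by (simp add: k_def)
qed

section \<open>Positivity of \<open>cstar x * x\<close> and equality of the two cones\<close>

text \<open>For nonzero \<open>c\<close>, both \<open>norm c + c\<close> and
  \<open>norm c - c\<close> would be invertible. So would their product, against
  \<open>hermitian_norm_in_spectrum\<close>.\<close>

lemma cpos_antisym: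
  fixes c :: "'a::cstar_algebra_1"
  assumes "cpos c" "cpos (- c)"
  shows "c = 0"
proof (rule ccontr)
  assume "c \<noteq> 0"
  then have k: "norm c > 0" by simp
  have "cinvertible ((of_real (norm c) + c) * (of_real (norm c) + - c))"
    using k assms by (intro cinvertible_mult cpos_cinvertible)
  also have "(of_real (norm c) + c) * (of_real (norm c) + - c) = of_real ((norm c)\<^sup>2) - c * c"
    by (simp add: algebra_simps of_real_def power2_eq_square)
  finally show False using hermitian_norm_in_spectrum[of c] \<open>c \<noteq> 0\<close> assms(1) by (simp add: cpos_def)
qed

text \<open>With real and imaginary parts \<open>u\<close>, \<open>v\<close> of \<open>y\<close>,
  the sum of \<open>y * cstar y\<close> and \<open>cstar y * y\<close> is
  \<open>2 (u u + v v)\<close>, so \<open>y * cstar y\<close> is positive. Jacobson's lemma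
  transfers negativity of \<open>cstar y * y\<close> to \<open>y * cstar y\<close>, which therefore
  vanishes.\<close>

lemma eq_0_if_cstar_mult_neg_square:
  fixes y :: "'a::cstar_algebra_1"
  assumes h: "cstar h = h" and y: "cstar y * y = - (h * h)"
  shows "y = 0"
proof -
  define u where "u = (1/2) *\<^sub>R (y + cstar y)"
  define v where "v = scaleC (- \<i> / 2) (y - cstar y)"
  have hu: "cstar u = u" by (simp add: u_def cstar_scaleR cstar_add cstar_cstar add.commute)
  have hv: "cstar v = v"
    by (simp add: v_def cstar_scaleC cstar_diff cstar_cstar scaleC_minus_left scaleC_diff_right)
  have "u * u = (1/4) *\<^sub>R ((y + cstar y) * (y + cstar y))" by (simp add: u_def)
  moreover have "v * v = (1/4) *\<^sub>R (- ((y - cstar y) * (y - cstar y)))"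
    by (simp add: v_def mult_scaleC_left mult_scaleC_right scaleC_scaleC scaleR_scaleC
        scaleC_minus_left scaleC_minus_right)
  moreover have "(y + cstar y) * (y + cstar y) - (y - cstar y) * (y - cstar y)
      = 2 *\<^sub>R (y * cstar y + cstar y * y)"
    by (simp add: algebra_simps scaleR_2)
  ultimately have "u * u + v * v = (1/4) *\<^sub>R (2 *\<^sub>R (y * cstar y + cstar y * y))"
    by (simp only: scaleR_right_distrib[symmetric]) simp
  then have "y * cstar y = 2 *\<^sub>R (u * u + v * v) + h * h" by (simp add: y)
  then have "ccone (y * cstar y)"
    by (auto intro!: ccone_add ccone_scaleR ccone_square simp: hu hv h)
  then have 1: "cpos (y * cstar y)" by (rule ccone_imp_cpos)
  have 2: "cpos (- (y * cstar y))"
  proof (rule cposI)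
    fix t :: real assume t: "t > 0"
    have "cpos (h * h)" by (intro ccone_imp_cpos ccone_square h)
    then have "cinvertible ((1/t) *\<^sub>R (of_real t + h * h))"
      using t by (intro cinvertible_scaleR cpos_cinvertible) auto
    also have "(1/t) *\<^sub>R (of_real t + h * h) = 1 - cstar y * ((1/t) *\<^sub>R y)"
      using t by (simp add: y algebra_simps of_real_def)
    finally have "cinvertible (t *\<^sub>R (1 - ((1/t) *\<^sub>R y) * cstar y))"
      using t by (intro cinvertible_scaleR[OF cinvertible_one_minus_swap]) auto
    also have "t *\<^sub>R (1 - ((1/t) *\<^sub>R y) * cstar y) = of_real t + - (y * cstar y)"
      using t by (simp add: algebra_simps of_real_def)
    finally show "cinvertible (of_real t + - (y * cstar y))" .
  qed (simp add: cstar_minus cstar_mult cstar_cstar)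
  have "cstar (cstar y) * cstar y = 0" using cpos_antisym[OF 1 2] by (simp add: cstar_cstar)
  then show ?thesis using cstar_identity[of "cstar y"] by simp
qed

text \<open>\<open>m\<close> is the modulus of \<open>a\<close>, the positive root of its
  square.\<close>

lemma hermitian_abs:
  fixes a :: "'a::cstar_algebra_1"
  assumes h: "cstar a = a"
  obtains m where "ccone m" "m * m = a * a" "\<And>x. x * a = a * x \<Longrightarrow> x * m = m * x"
proof -
  obtain m where m: "ccone m" "m * m = a * a" "\<And>x. x * (a * a) = (a * a) * x \<Longrightarrow> x * m = m * x"
    using ccone_sqrt[OF ccone_square[OF h]] by metis
  moreover have "x * m = m * x" if "x * a = a * x" for x
    using that by (intro m(3)) (metis mult.assoc)
  ultimately show thesis using that by blast
qed

text \<open>Here \<open>n\<close> is twice the negative part of \<open>a\<close>, and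
  \<open>a * n = - (m * n)\<close>. Cutting \<open>x\<close> down to \<open>x * n\<close> thus gives
  minus the square of the hermitian \<open>q * n\<close>, where \<open>q\<close> is the root of the
  modulus. The preceding vanishing result kills \<open>x * n\<close>, then \<open>n\<close> itself,
  and \<open>a\<close> equals its modulus.\<close>

lemma ccone_cstar_mult:
  fixes x :: "'a::cstar_algebra_1"
  shows "ccone (cstar x * x)"
proof -
  define a where "a = cstar x * x"
  have h: "cstar a = a" by (simp add: a_def cstar_mult cstar_cstar)
  obtain m where m: "ccone m" "m * m = a * a" "\<And>x. x * a = a * x \<Longrightarrow> x * m = m * x"
    using hermitian_abs[OF h] by metis
  obtain q where q: "ccone q" "q * q = m" "\<And>x. x * m = m * x \<Longrightarrow> x * q = q * x"
    using ccone_sqrt[OF m(1)] by metis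
  have am: "a * m = m * a" by (rule m(3)) simp
  have aq: "a * q = q * a" using am by (rule q(3))
  have mq: "m * q = q * m" by (rule q(3)) simp
  define n where "n = m - a"
  have hn: "cstar n = n" using ccone_hermitian[OF m(1)] h by (simp add: n_def cstar_diff)
  have an: "a * n = - (m * n)" using am m(2) by (simp add: n_def algebra_simps)
  have mn: "m * n = n * m" using am by (simp add: n_def algebra_simps)
  have nq: "n * q = q * n" using aq mq by (simp add: n_def algebra_simps)
  have "cstar (x * n) * (x * n) = n * (a * n)" by (simp add: cstar_mult hn a_def mult.assoc)
  also have "\<dots> = - ((q * n) * (q * n))"
    unfolding an using nq mn by (simp flip: q(2)) (metis mult.assoc)
  finally have "x * n = 0"
    using ccone_hermitian[OF q(1)] hn nq
    by (intro eq_0_if_cstar_mult_neg_square[of "q * n"]) (simp_all add: cstar_mult)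
  then have a0: "a * n = 0" by (simp add: a_def mult.assoc)
  then have "m * n = 0" using an by simp
  then have "n * n = 0" using a0 by (simp add: n_def algebra_simps)
  then have "n = 0" using norm_square_hermitian[OF hn] by simp
  then show ?thesis using m(1) by (simp add: n_def a_def)
qed

text \<open>Let \<open>p\<close> and \<open>n\<close> be the positive and negative parts. Since
  \<open>n * p = 0\<close>, the product of \<open>t + n\<close> and \<open>t + p\<close> is
  \<open>t (t + m)\<close>, and that of \<open>t - n\<close> and \<open>t + p\<close> is
  \<open>t (t + a)\<close>. Both right sides are invertible, so \<open>n\<close> and
  \<open>- n\<close> are positive and \<open>n = 0\<close>.\<close>

lemma cpos_imp_ccone:
  fixes a :: "'a::cstar_algebra_1"
  assumes a: "cpos a"
  shows "ccone a"
proof -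
  have h: "cstar a = a" using a by (simp add: cpos_def)
  obtain m where m: "ccone m" "m * m = a * a" "\<And>x. x * a = a * x \<Longrightarrow> x * m = m * x"
    using hermitian_abs[OF h] by metis
  have am: "a * m = m * a" by (rule m(3)) simp
  define n where "n = (1/2) *\<^sub>R (m - a)"
  define p where "p = (1/2) *\<^sub>R (m + a)"
  have hn: "cstar n = n" using ccone_hermitian[OF m(1)] h by (simp add: n_def cstar_scaleR cstar_diff)
  have np: "n * p = 0" "p * n = 0" using am m(2) by (simp_all add: n_def p_def algebra_simps)
  have ma: "m = p + n" "a = p - n"
    by (simp_all add: n_def p_def algebra_simps flip: scaleR_add_left)
  have "cpos n"
  proof (rule cposI[OF hn])
    fix t :: real assume t: "t > 0"
    have "(of_real t + n) * (of_real t + p) = t *\<^sub>R (of_real t + m)"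
      "(of_real t + p) * (of_real t + n) = t *\<^sub>R (of_real t + m)"
      by (simp_all add: ma np algebra_simps of_real_def)
    moreover have "cinvertible (t *\<^sub>R (of_real t + m))"
      using t m(1) by (intro cinvertible_scaleR cpos_cinvertible ccone_imp_cpos) auto
    ultimately show "cinvertible (of_real t + n)"
      using cinvertible_factor[of "of_real t + n" "of_real t + p"] by simp
  qed
  moreover have "cpos (- n)"
  proof (rule cposI)
    fix t :: real assume t: "t > 0"
    have "(of_real t + - n) * (of_real t + p) = t *\<^sub>R (of_real t + a)"
      "(of_real t + p) * (of_real t + - n) = t *\<^sub>R (of_real t + a)"
      by (simp_all add: ma np algebra_simps of_real_def)
    moreover have "cinvertible (t *\<^sub>R (of_real t + a))"
      using t a by (intro cinvertible_scaleR cpos_cinvertible) auto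
    ultimately show "cinvertible (of_real t + - n)"
      using cinvertible_factor[of "of_real t + - n" "of_real t + p"] by simp
  qed (simp add: cstar_minus hn)
  ultimately have "n = 0" by (rule cpos_antisym)
  then show ?thesis using m(1) ma by simp
qed

lemma cpos_cstar_mult: "cpos (cstar x * (x::'a::cstar_algebra_1))"
  by (intro ccone_imp_cpos ccone_cstar_mult)

text \<open>With a hermitian root \<open>s\<close> of \<open>a\<close>, the element is
  \<open>cstar y * y\<close> for \<open>y = s * x\<close>.\<close>

lemma cpos_conjugate:
  fixes a :: "'a::cstar_algebra_1"
  assumes "cpos a"
  shows "cpos (cstar x * (a * x))"
proof -
  obtain s where s: "ccone s" "s * s = a"
    by (rule ccone_sqrt[OF cpos_imp_ccone[OF assms]]) blast
  have "cstar (s * x) * (s * x) = cstar x * (a * x)"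
    using ccone_hermitian[OF s(1)] by (simp add: cstar_mult mult.assoc flip: s(2))
  then show ?thesis using cpos_cstar_mult[of "s * x"] by simp
qed

text \<open>The order-unit bound from which all boundedness of the forms built from \<omega> is
  derived; the cone witness is \<open>norm a\<close>.\<close>

lemma cpos_norm_diff:
  fixes a :: "'a::cstar_algebra_1"
  assumes "cstar a = a"
  shows "cpos (of_real (norm a) - a)"
  by (rule ccone_imp_cpos) (auto simp: ccone_def cstar_diff assms intro!: exI[of _ "norm a"])

lemma hermitian_decomposition:
  fixes b :: "'a::cstar_algebra_1"
  obtains h k where "cstar h = h" "cstar k = k" "b = h + scaleC \<i> k"
proof -
  define h where "h = scaleC (1/2) (b + cstar b)"
  define k where "k = scaleC (- \<i> / 2) (b - cstar b)"
  have "cstar h = h" by (simp add: h_def cstar_scaleC cstar_add cstar_cstar add.commute)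
  moreover have "cstar k = k"
    by (simp add: k_def cstar_scaleC cstar_diff cstar_cstar scaleC_minus_left scaleC_diff_right)
  moreover have "b = h + scaleC \<i> k"
    using scaleC_add_left[of "1/2" "1/2" b]
    by (simp add: h_def k_def scaleC_scaleC scaleC_add_right scaleC_diff_right scaleC_one)
  ultimately show thesis by (rule that)
qed

section \<open>The space l2(I) and its bounded operators\<close>

text \<open>The discriminant argument, isolated because it serves l2(I), semi-inner products and the
  distance estimate for \<open>approx_normal\<close>. The multiplier is \<open>- t * c\<close>, with
  optimal \<open>t = 1 / b\<close>.\<close>

lemma cauchy_schwarz_of_quadratic:
  fixes a b :: real and c :: complex
  assumes q: "\<And>l. 0 \<le> a + 2 * Re (cnj l * c) + (cmod l)\<^sup>2 * b" and b: "0 \<le> b"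
  shows "(cmod c)\<^sup>2 \<le> a * b"
proof -
  have "0 \<le> a - 2 * t * (cmod c)\<^sup>2 + t\<^sup>2 * (cmod c)\<^sup>2 * b" for t
    using q[of "- complex_of_real t * c"]
    by (simp add: norm_mult power_mult_distrib complex_norm_square[symmetric] mult.assoc
        cmod_power2 algebra_simps flip: power2_eq_square)
  note t = this
  show ?thesis
  proof (cases "b = 0")
    case True
    have "(cmod c)\<^sup>2 = 0"
    proof (rule ccontr)
      assume "(cmod c)\<^sup>2 \<noteq> 0"
      \<comment> \<open>For \<open>b = 0\<close> the bound is linear in \<open>t\<close>; this value
        makes it \<open>- a - 2\<close>, while \<open>t = 0\<close> gives
        \<open>a \<ge> 0\<close>.\<close>
      then show False using t[of "(a + 1) / (cmod c)\<^sup>2"] t[of 0] True by simp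
    qed
    then show ?thesis using True by simp
  next
    case False
    then have "b > 0" using b by simp
    have "0 \<le> (a - 2 * (1 / b) * (cmod c)\<^sup>2 + (1 / b)\<^sup>2 * (cmod c)\<^sup>2 * b) * b"
      using t[of "1 / b"] b by (intro mult_nonneg_nonneg) auto
    also have "\<dots> = a * b - (cmod c)\<^sup>2"
      using \<open>b > 0\<close> by (simp add: field_simps power2_eq_square)
    finally show ?thesis by simp
  qed
qed

section \<open>Inner product and norm of l2(I)\<close>

lemma l2_summable: "x \<in> l2 I \<Longrightarrow> (\<lambda>i. (cmod (x i))\<^sup>2) summable_on I"
  by (simp add: l2_def)

lemma l2_zero [simp]: "(\<lambda>_. 0) \<in> l2 I"
  by (simp add: l2_def)

lemma l2_scale:
  assumes "x \<in> l2 I"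
  shows "(\<lambda>i. c * x i) \<in> l2 I"
  using summable_on_cmult_right[OF l2_summable[OF assms], of "(cmod c)\<^sup>2"] assms
  by (simp add: l2_def norm_mult power_mult_distrib)

lemma l2_add:
  assumes "x \<in> l2 I" "y \<in> l2 I"
  shows "(\<lambda>i. x i + y i) \<in> l2 I"
proof -
  have "(\<lambda>i. 2 * (cmod (x i))\<^sup>2 + 2 * (cmod (y i))\<^sup>2) summable_on I"
    by (intro summable_on_add summable_on_cmult_right l2_summable assms)
  moreover have "(cmod (x i + y i))\<^sup>2 \<le> 2 * (cmod (x i))\<^sup>2 + 2 * (cmod (y i))\<^sup>2" for i
  proof -
    have "(cmod (x i + y i))\<^sup>2 \<le> (cmod (x i) + cmod (y i))\<^sup>2"
      by (simp add: norm_triangle_ineq power_mono)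
    also have "\<dots> \<le> 2 * (cmod (x i))\<^sup>2 + 2 * (cmod (y i))\<^sup>2"
      using sum_squares_bound[of "cmod (x i)" "cmod (y i)"] by (simp add: power2_sum)
    finally show ?thesis .
  qed
  ultimately have "(\<lambda>i. (cmod (x i + y i))\<^sup>2) summable_on I"
    by (rule summable_on_comparison_test) simp_all
  then show ?thesis using assms by (simp add: l2_def)
qed

lemma l2_uminus: "x \<in> l2 I \<Longrightarrow> (\<lambda>i. - x i) \<in> l2 I"
  using l2_scale[of x I "- 1"] by simp

lemma l2_diff: "x \<in> l2 I \<Longrightarrow> y \<in> l2 I \<Longrightarrow> (\<lambda>i. x i - y i) \<in> l2 I"
  using l2_add[OF _ l2_uminus, of x I y] by simp

lemma l2_inner_summable:
  assumes "x \<in> l2 I" "y \<in> l2 I"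
  shows "(\<lambda>i. cnj (x i) * y i) summable_on I"
proof (rule abs_summable_summable, rule abs_summable_on_comparison_test)
  show "(\<lambda>i. (cmod (x i))\<^sup>2 + (cmod (y i))\<^sup>2) abs_summable_on I"
    using summable_on_add[OF assms[THEN l2_summable]] by simp
  show "norm (cnj (x i) * y i) \<le> norm ((cmod (x i))\<^sup>2 + (cmod (y i))\<^sup>2)" for i
  proof -
    have "0 \<le> cmod (x i) * cmod (y i)" by simp
    then have "cmod (x i) * cmod (y i) \<le> (cmod (x i))\<^sup>2 + (cmod (y i))\<^sup>2"
      using sum_squares_bound[of "cmod (x i)" "cmod (y i)"] by linarith
    then show ?thesis by (simp add: norm_mult)
  qed
qed

lemma l2_inner_add_right:
  assumes "x \<in> l2 I" "y \<in> l2 I" "z \<in> l2 I"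
  shows "l2_inner I x (\<lambda>i. y i + z i) = l2_inner I x y + l2_inner I x z"
  unfolding l2_inner_def distrib_left by (intro infsum_add l2_inner_summable assms)

lemma l2_inner_scale_right:
  assumes "x \<in> l2 I" "y \<in> l2 I"
  shows "l2_inner I x (\<lambda>i. c * y i) = c * l2_inner I x y"
  unfolding l2_inner_def
  using infsum_cmult_right[OF l2_inner_summable[OF assms], of c] by (simp add: ac_simps)

lemma l2_inner_cnj: "cnj (l2_inner I x y) = l2_inner I y x"
  unfolding l2_inner_def by (simp add: mult.commute flip: infsum_cnj)

lemma l2_inner_add_left:
  assumes "x \<in> l2 I" "y \<in> l2 I" "z \<in> l2 I"
  shows "l2_inner I (\<lambda>i. x i + y i) z = l2_inner I x z + l2_inner I y z"
  using arg_cong[OF l2_inner_add_right[OF assms(3,1,2)], of cnj] by (simp add: l2_inner_cnj)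

lemma l2_inner_scale_left:
  assumes "x \<in> l2 I" "y \<in> l2 I"
  shows "l2_inner I (\<lambda>i. c * x i) y = cnj c * l2_inner I x y"
  using arg_cong[OF l2_inner_scale_right[OF assms(2,1)], of cnj] by (simp add: l2_inner_cnj)

lemma l2_inner_diff_right:
  assumes "x \<in> l2 I" "y \<in> l2 I" "z \<in> l2 I"
  shows "l2_inner I x (\<lambda>i. y i - z i) = l2_inner I x y - l2_inner I x z"
  using l2_inner_add_right[OF assms(1,2) l2_uminus[OF assms(3)]]
    l2_inner_scale_right[OF assms(1,3), of "- 1"] by simp

lemma l2_inner_diff_left:
  assumes "x \<in> l2 I" "y \<in> l2 I" "z \<in> l2 I"
  shows "l2_inner I (\<lambda>i. x i - y i) z = l2_inner I x z - l2_inner I y z"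
  using arg_cong[OF l2_inner_diff_right[OF assms(3,1,2)], of cnj] by (simp add: l2_inner_cnj)

lemma l2_inner_zero_left [simp]: "l2_inner I (\<lambda>_. 0) x = 0"
  by (simp add: l2_inner_def)

lemma l2_norm_nonneg [simp]: "0 \<le> l2_norm I x"
  by (simp add: l2_norm_def infsum_nonneg)

lemma l2_norm_power2: "(l2_norm I x)\<^sup>2 = infsum (\<lambda>i. (cmod (x i))\<^sup>2) I"
  by (simp add: l2_norm_def infsum_nonneg)

lemma l2_inner_self:
  assumes "x \<in> l2 I"
  shows "l2_inner I x x = complex_of_real ((l2_norm I x)\<^sup>2)"
proof -
  have "(\<lambda>i. cnj (x i) * x i) = (\<lambda>i. complex_of_real ((cmod (x i))\<^sup>2))"
    by (simp only: complex_norm_square mult.commute)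
  moreover have "((\<lambda>i. complex_of_real ((cmod (x i))\<^sup>2)) has_sum
      complex_of_real ((l2_norm I x)\<^sup>2)) I"
    unfolding l2_norm_power2 by (intro has_sum_of_real has_sum_infsum l2_summable assms)
  ultimately show ?thesis unfolding l2_inner_def by (simp add: infsumI)
qed

lemma l2_norm_scale:
  assumes "x \<in> l2 I"
  shows "l2_norm I (\<lambda>i. c * x i) = cmod c * l2_norm I x"
  unfolding l2_norm_def norm_mult power_mult_distrib
    infsum_cmult_right[OF l2_summable[OF assms]] real_sqrt_mult by simp

lemma l2_norm_add_power2:
  assumes "x \<in> l2 I" "y \<in> l2 I"
  shows "(l2_norm I (\<lambda>i. x i + y i))\<^sup>2
    = (l2_norm I x)\<^sup>2 + 2 * Re (l2_inner I x y) + (l2_norm I y)\<^sup>2"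
proof -
  have "complex_of_real ((l2_norm I (\<lambda>i. x i + y i))\<^sup>2)
    = complex_of_real ((l2_norm I x)\<^sup>2) + (l2_inner I x y + cnj (l2_inner I x y))
      + complex_of_real ((l2_norm I y)\<^sup>2)"
    by (simp add: assms l2_add l2_inner_add_left l2_inner_add_right l2_inner_cnj
        flip: l2_inner_self del: of_real_power)
  then show ?thesis
    unfolding complex_add_cnj of_real_add[symmetric] of_real_eq_iff .
qed

lemma l2_norm_diff_power2:
  assumes "x \<in> l2 I" "y \<in> l2 I"
  shows "(l2_norm I (\<lambda>i. x i - y i))\<^sup>2
    = (l2_norm I x)\<^sup>2 - 2 * Re (l2_inner I x y) + (l2_norm I y)\<^sup>2"
  using l2_norm_add_power2[OF assms(1) l2_uminus[OF assms(2)]]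
    l2_inner_scale_right[OF assms, of "- 1"] l2_norm_scale[OF assms(2), of "- 1"] by simp

lemma l2_cauchy_schwarz:
  assumes "x \<in> l2 I" "y \<in> l2 I"
  shows "cmod (l2_inner I x y) \<le> l2_norm I x * l2_norm I y"
proof -
  have "(cmod (l2_inner I x y))\<^sup>2 \<le> (l2_norm I y)\<^sup>2 * (l2_norm I x)\<^sup>2"
  proof (rule cauchy_schwarz_of_quadratic)
    show "0 \<le> (l2_norm I y)\<^sup>2 + 2 * Re (cnj l * l2_inner I x y) + (cmod l)\<^sup>2 * (l2_norm I x)\<^sup>2" for l
      using l2_norm_add_power2[OF l2_scale[OF assms(1)] assms(2), of l]
        zero_le_power2[of "l2_norm I (\<lambda>i. l * x i + y i)"]
      by (simp add: l2_inner_scale_left l2_norm_scale assms power_mult_distrib)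
  qed simp
  then have "(cmod (l2_inner I x y))\<^sup>2 \<le> (l2_norm I x * l2_norm I y)\<^sup>2"
    by (simp add: power_mult_distrib mult.commute)
  then show ?thesis by (rule power2_le_imp_le) simp
qed

lemma l2_norm_triangle:
  assumes "x \<in> l2 I" "y \<in> l2 I"
  shows "l2_norm I (\<lambda>i. x i + y i) \<le> l2_norm I x + l2_norm I y"
proof (rule power2_le_imp_le)
  have "Re (l2_inner I x y) \<le> l2_norm I x * l2_norm I y"
    using l2_cauchy_schwarz[OF assms] complex_Re_le_cmod order_trans by blast
  then show "(l2_norm I (\<lambda>i. x i + y i))\<^sup>2 \<le> (l2_norm I x + l2_norm I y)\<^sup>2"
    by (simp add: l2_norm_add_power2 assms power2_sum)
qed simp

section \<open>Bounded operators on l2(I) and vector states\<close>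

lemma bop_l2: "T \<in> bop I \<Longrightarrow> x \<in> l2 I \<Longrightarrow> T x \<in> l2 I"
  and bop_outside: "T \<in> bop I \<Longrightarrow> x \<notin> l2 I \<Longrightarrow> T x = (\<lambda>_. 0)"
  and bop_add: "T \<in> bop I \<Longrightarrow> x \<in> l2 I \<Longrightarrow> y \<in> l2 I
    \<Longrightarrow> T (\<lambda>i. x i + y i) = (\<lambda>i. T x i + T y i)"
  and bop_scale: "T \<in> bop I \<Longrightarrow> x \<in> l2 I \<Longrightarrow> T (\<lambda>i. c * x i) = (\<lambda>i. c * T x i)"
  unfolding bop_def by blast+

lemma bop_diff:
  assumes "T \<in> bop I" "x \<in> l2 I" "y \<in> l2 I"
  shows "T (\<lambda>i. x i - y i) = (\<lambda>i. T x i - T y i)"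
  using bop_add[OF assms(1,2) l2_uminus[OF assms(3)]] bop_scale[OF assms(1,3), of "- 1"] by simp

lemma bop_bounded:
  assumes "T \<in> bop I"
  obtains K where "0 \<le> K" "\<And>x. x \<in> l2 I \<Longrightarrow> l2_norm I (T x) \<le> K * l2_norm I x"
proof -
  obtain K where K: "\<forall>x\<in>l2 I. l2_norm I (T x) \<le> K * l2_norm I x"
    using assms unfolding bop_def by blast
  have "l2_norm I (T x) \<le> max 0 K * l2_norm I x" if "x \<in> l2 I" for x
    using K that mult_right_mono[of K "max 0 K" "l2_norm I x"] by force
  then show thesis by (intro that[of "max 0 K"]) simp
qed

lemma bopI:
  assumes "\<And>x. x \<in> l2 I \<Longrightarrow> T x \<in> l2 I" "\<And>x. x \<notin> l2 I \<Longrightarrow> T x = (\<lambda>_. 0)"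
    "\<And>x y. x \<in> l2 I \<Longrightarrow> y \<in> l2 I \<Longrightarrow> T (\<lambda>i. x i + y i) = (\<lambda>i. T x i + T y i)"
    "\<And>x c. x \<in> l2 I \<Longrightarrow> T (\<lambda>i. c * x i) = (\<lambda>i. c * T x i)"
    "\<And>x. x \<in> l2 I \<Longrightarrow> l2_norm I (T x) \<le> K * l2_norm I x"
  shows "T \<in> bop I"
  using assms unfolding bop_def by blast

lemma bop_op_id: "op_id I \<in> bop I"
  by (rule bopI[where K = 1]) (auto simp: op_id_def l2_add l2_scale)

lemma bop_plus:
  assumes "S \<in> bop I" "T \<in> bop I"
  shows "S + T \<in> bop I"
proof -
  obtain K where K: "\<And>x. x \<in> l2 I \<Longrightarrow> l2_norm I (S x) \<le> K * l2_norm I x"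
    using bop_bounded[OF assms(1)] by blast
  obtain L where L: "\<And>x. x \<in> l2 I \<Longrightarrow> l2_norm I (T x) \<le> L * l2_norm I x"
    using bop_bounded[OF assms(2)] by blast
  show ?thesis
  proof (rule bopI[where K = "K + L"])
    fix x assume x: "x \<in> l2 I"
    show "(S + T) x \<in> l2 I" using assms x by (simp add: plus_fun_def l2_add bop_l2)
    show "(S + T) (\<lambda>i. c * x i) = (\<lambda>i. c * (S + T) x i)" for c
      using assms x by (simp add: plus_fun_def bop_scale algebra_simps)
    show "l2_norm I ((S + T) x) \<le> (K + L) * l2_norm I x"
      using l2_norm_triangle[of "S x" I "T x"] K[OF x] L[OF x] assms x
      by (simp add: plus_fun_def bop_l2 algebra_simps)
  qed (use assms in \<open>auto simp: plus_fun_def bop_add bop_outside algebra_simps\<close>)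
qed

lemma bop_op_scale:
  assumes "T \<in> bop I"
  shows "op_scale c T \<in> bop I"
proof -
  obtain K where K: "\<And>x. x \<in> l2 I \<Longrightarrow> l2_norm I (T x) \<le> K * l2_norm I x"
    using bop_bounded[OF assms] by blast
  show ?thesis
  proof (rule bopI[where K = "cmod c * K"])
    fix x assume x: "x \<in> l2 I"
    show "l2_norm I (op_scale c T x) \<le> cmod c * K * l2_norm I x"
      using mult_left_mono[OF K[OF x], of "cmod c"] assms x
      by (simp add: op_scale_def l2_norm_scale bop_l2 mult.assoc)
  qed (use assms in \<open>auto simp: op_scale_def bop_add bop_scale bop_outside bop_l2 l2_scale algebra_simps\<close>)
qed

lemma bop_comp:
  assumes "S \<in> bop I" "T \<in> bop I"
  shows "S \<circ> T \<in> bop I"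
proof -
  obtain K where K: "0 \<le> K" "\<And>x. x \<in> l2 I \<Longrightarrow> l2_norm I (S x) \<le> K * l2_norm I x"
    using bop_bounded[OF assms(1)] by blast
  obtain L where L: "\<And>x. x \<in> l2 I \<Longrightarrow> l2_norm I (T x) \<le> L * l2_norm I x"
    using bop_bounded[OF assms(2)] by blast
  have S0: "S (\<lambda>_. 0) = (\<lambda>_. 0)" using bop_scale[OF assms(1) l2_zero, of 0] by simp
  show ?thesis
  proof (rule bopI[where K = "K * L"])
    fix x assume x: "x \<in> l2 I"
    show "l2_norm I ((S \<circ> T) x) \<le> K * L * l2_norm I x"
      using K(2)[OF bop_l2[OF assms(2) x]] mult_left_mono[OF L[OF x] K(1)] by simp
  qed (use assms S0 in \<open>auto simp: bop_add bop_scale bop_outside bop_l2\<close>)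
qed

lemma op_norm_bound:
  assumes T: "T \<in> bop I" and x: "x \<in> l2 I" "l2_norm I x \<le> 1"
  shows "l2_norm I (T x) \<le> op_norm I T"
proof -
  obtain K where K: "0 \<le> K" "\<And>x. x \<in> l2 I \<Longrightarrow> l2_norm I (T x) \<le> K * l2_norm I x"
    using bop_bounded[OF T] by blast
  have "l2_norm I (T y) \<le> K" if "y \<in> l2 I" "l2_norm I y \<le> 1" for y
    using K(2)[OF that(1)] mult_left_mono[OF that(2) K(1)] by simp
  then have "bdd_above ((\<lambda>x. l2_norm I (T x)) ` {x \<in> l2 I. l2_norm I x \<le> 1})"
    by (intro bdd_aboveI[of _ K]) auto
  then show ?thesis unfolding op_norm_def using x by (intro cSUP_upper) auto
qed

text \<open>Cauchy-Schwarz bounds the supremum by 1, and the identity operator attains it.\<close>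

lemma vector_state:
  assumes xi: "\<xi> \<in> l2 I" "l2_norm I \<xi> = 1"
  shows "bh_state I (\<lambda>T. l2_inner I \<xi> (T \<xi>))"
  unfolding bh_state_def
proof (intro conjI ballI allI impI)
  show "l2_inner I \<xi> ((S + T) \<xi>) = l2_inner I \<xi> (S \<xi>) + l2_inner I \<xi> (T \<xi>)"
    if "S \<in> bop I" "T \<in> bop I" for S T
    using that xi by (simp add: plus_fun_def l2_inner_add_right bop_l2)
  show "l2_inner I \<xi> (op_scale c T \<xi>) = c * l2_inner I \<xi> (T \<xi>)" if "T \<in> bop I" for c T
    using that xi by (simp add: op_scale_def l2_inner_scale_right bop_l2)
  show "0 \<le> l2_inner I \<xi> (T \<xi>)" if "op_pos I T" for T
    using that xi by (simp add: op_pos_def)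
  have "cmod (l2_inner I \<xi> (T \<xi>)) \<le> 1" if "T \<in> bop I" "op_norm I T \<le> 1" for T
    using l2_cauchy_schwarz[OF xi(1) bop_l2[OF that(1) xi(1)]] op_norm_bound[OF that(1) xi(1)] xi(2) that(2)
    by simp
  moreover have "op_norm I (op_id I) \<le> 1"
    unfolding op_norm_def by (rule cSUP_least) (auto simp: op_id_def l2_norm_def intro!: exI[of _ "\<lambda>_. 0"])
  moreover have "cmod (l2_inner I \<xi> (op_id I \<xi>)) = 1"
    using xi by (simp add: op_id_def l2_inner_self)
  ultimately show "(SUP T\<in>{T \<in> bop I. op_norm I T \<le> 1}. cmod (l2_inner I \<xi> (T \<xi>))) = 1"
    by (intro cSup_eq_maximum) (auto intro!: image_eqI[of _ _ "op_id I"] bop_op_id)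
qed

section \<open>Gram--Schmidt in a semi-inner product space\<close>

text \<open>Definiteness is left out so that the algebra itself, null vectors included, can carry
  the GNS form without a quotient.\<close>

locale complex_semi_inner = vector_space scale
  for scale :: "complex \<Rightarrow> 'v::ab_group_add \<Rightarrow> 'v" (infixr \<open>*s\<close> 75) +
  fixes ip :: "'v \<Rightarrow> 'v \<Rightarrow> complex"
  assumes ip_add_right: "ip x (y + z) = ip x y + ip x z"
    and ip_scale_right: "ip x (c *s y) = c * ip x y"
    and ip_cnj: "cnj (ip x y) = ip y x"
    and ip_self_nonneg: "0 \<le> Re (ip x x)"
begin

definition sqn :: "'v \<Rightarrow> real" where "sqn x = Re (ip x x)"

lemma sqn_nonneg [simp]: "0 \<le> sqn x"
  by (simp add: sqn_def ip_self_nonneg)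

lemma ip_self: "ip x x = complex_of_real (sqn x)"
  using arg_cong[OF ip_cnj[of x x], of Im] by (simp add: sqn_def complex_eq_iff)

lemma ip_add_left: "ip (x + y) z = ip x z + ip y z"
  using arg_cong[OF ip_add_right[of z x y], of cnj] by (simp add: ip_cnj)

lemma ip_scale_left: "ip (c *s x) y = cnj c * ip x y"
  using arg_cong[OF ip_scale_right[of y c x], of cnj] by (simp add: ip_cnj)

lemma ip_zero_right [simp]: "ip x 0 = 0"
  using ip_add_right[of x 0 0] by simp

lemma ip_zero_left [simp]: "ip 0 x = 0"
  using ip_add_left[of 0 0 x] by simp

lemma ip_diff_right: "ip x (y - z) = ip x y - ip x z"
  using ip_add_right[of x "y - z" z] by simp

lemma ip_diff_left: "ip (x - y) z = ip x z - ip y z"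
  using ip_add_left[of "x - y" y z] by simp

lemma ip_sum_left: "ip (\<Sum>i\<in>F. h i) x = (\<Sum>i\<in>F. ip (h i) x)"
  by (induction F rule: infinite_finite_induct) (simp_all add: ip_add_left)

lemma ip_sum_right: "ip x (\<Sum>i\<in>F. h i) = (\<Sum>i\<in>F. ip x (h i))"
  by (induction F rule: infinite_finite_induct) (simp_all add: ip_add_right)

lemma cmod_ip_commute: "cmod (ip x y) = cmod (ip y x)"
  by (metis complex_mod_cnj ip_cnj)

lemma sqn_add: "sqn (x + y) = sqn x + 2 * Re (ip y x) + sqn y"
  using arg_cong[OF ip_cnj[of x y], of Re] by (simp add: sqn_def ip_add_left ip_add_right)

lemma sqn_diff: "sqn (x - y) = sqn x - 2 * Re (ip y x) + sqn y"
  using arg_cong[OF ip_cnj[of x y], of Re] by (simp add: sqn_def ip_diff_left ip_diff_right)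

lemma sqn_scale: "sqn (c *s x) = (cmod c)\<^sup>2 * sqn x"
proof -
  have "complex_of_real (sqn (c *s x)) = (c * cnj c) * complex_of_real (sqn x)"
    by (simp add: ip_scale_left ip_scale_right flip: ip_self)
  then show ?thesis
    unfolding complex_norm_square[symmetric] of_real_mult[symmetric] of_real_eq_iff .
qed

lemma cauchy_schwarz: "(cmod (ip x y))\<^sup>2 \<le> sqn x * sqn y"
proof -
  have "0 \<le> sqn x + 2 * Re (cnj l * ip y x) + (cmod l)\<^sup>2 * sqn y" for l
    using sqn_nonneg[of "x + l *s y"] by (simp add: sqn_add sqn_scale ip_scale_left)
  then have "(cmod (ip y x))\<^sup>2 \<le> sqn x * sqn y"
    by (rule cauchy_schwarz_of_quadratic) simp
  then show ?thesis by (simp add: cmod_ip_commute)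
qed

lemma cauchy_schwarz_sqrt: "cmod (ip x y) \<le> sqrt (sqn x) * sqrt (sqn y)"
  using cauchy_schwarz[of x y] by (metis real_le_rsqrt real_sqrt_mult)

definition cauchy_seq :: "(nat \<Rightarrow> 'v) \<Rightarrow> bool" where
  "cauchy_seq g \<longleftrightarrow> (\<forall>e>0. \<exists>N. \<forall>m\<ge>N. \<forall>n\<ge>N. sqn (g m - g n) < e)"

text \<open>Stands in for evaluating a bounded additive functional at the limit vector, which exists
  only in the completion.\<close>

lemma cauchy_seq_convergent:
  fixes F :: "'v \<Rightarrow> complex"
  assumes g: "cauchy_seq g" and F: "\<And>x y. F (x - y) = F x - F y"
    "\<And>x. cmod (F x) \<le> C * sqrt (sqn x)"
  shows "convergent (\<lambda>n. F (g n))"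
proof -
  have "Cauchy (\<lambda>n. F (g n))"
  proof (rule CauchyI)
    fix e :: real assume e: "0 < e"
    \<comment> \<open>\<open>C\<close> may be 0 or negative, while \<open>e / K\<close> requires a
      positive bound.\<close>
    define K where "K = max C 1"
    have K: "K > 0" "C \<le> K" by (auto simp: K_def)
    have "0 < (e / K)\<^sup>2" using e K by simp
    then obtain N where N: "\<And>m n. m \<ge> N \<Longrightarrow> n \<ge> N \<Longrightarrow> sqn (g m - g n) < (e / K)\<^sup>2"
      using g unfolding cauchy_seq_def by blast
    have "norm (F (g m) - F (g n)) < e" if "m \<ge> N" "n \<ge> N" for m n
    proof -
      have "sqrt (sqn (g m - g n)) < e / K"
        using N[OF that] e K by (intro real_less_lsqrt) auto
      then have "K * sqrt (sqn (g m - g n)) < e" using K by (simp add: field_simps)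
      moreover have "C * sqrt (sqn (g m - g n)) \<le> K * sqrt (sqn (g m - g n))"
        using K by (intro mult_right_mono) auto
      ultimately show ?thesis using F(2)[of "g m - g n"] by (simp add: F(1))
    qed
    then show "\<exists>M. \<forall>m\<ge>M. \<forall>n\<ge>M. norm (F (g m) - F (g n)) < e" by blast
  qed
  then show ?thesis by (rule Cauchy_convergent)
qed

text \<open>A sequence which in the completion would converge to a unit vector orthogonal to \<open>V\<close>.\<close>

definition approx_normal :: "'v set \<Rightarrow> (nat \<Rightarrow> 'v) \<Rightarrow> bool" where
  "approx_normal V g \<longleftrightarrow> (\<forall>m n. g m - g n \<in> V) \<and> (\<lambda>n. sqn (g n)) \<longlonglongrightarrow> 1
     \<and> (\<forall>n. \<forall>w\<in>V. 1 \<le> sqn (g n + w))"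

context
  fixes V :: "'v set" and g :: "nat \<Rightarrow> 'v"
  assumes V: "subspace V" and g: "approx_normal V g"
begin

lemma approx_normal_sqn: "(\<lambda>n. sqn (g n)) \<longlonglongrightarrow> 1"
  using g by (simp add: approx_normal_def)

lemma approx_normal_sqn_ge: "1 \<le> sqn (g n)"
  using g subspace_0[OF V] unfolding approx_normal_def by (metis add.right_neutral)

text \<open>The lower bound 1 on \<open>sqn (g n + l *s w)\<close> is a nonnegative quadratic in
  \<open>l\<close>: how far \<open>sqn (g n)\<close> exceeds 1 limits the component along
  \<open>V\<close>.\<close>

lemma approx_normal_ip:
  assumes "w \<in> V"
  shows "(cmod (ip (g n) w))\<^sup>2 \<le> (sqn (g n) - 1) * sqn w"
proof -
  have "0 \<le> (sqn (g n) - 1) + 2 * Re (cnj l * ip w (g n)) + (cmod l)\<^sup>2 * sqn w" for l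
  proof -
    have "1 \<le> sqn (g n + l *s w)"
      using g assms subspace_scale[OF V] by (simp add: approx_normal_def)
    then show ?thesis by (simp add: sqn_add sqn_scale ip_scale_left)
  qed
  then have "(cmod (ip w (g n)))\<^sup>2 \<le> (sqn (g n) - 1) * sqn w"
    by (rule cauchy_schwarz_of_quadratic) simp
  then show ?thesis by (simp add: cmod_ip_commute)
qed

text \<open>The difference \<open>w\<close> lies in \<open>V\<close>, so writing
  \<open>sqn w\<close> as a difference of inner products with \<open>w\<close> bounds it through
  \<open>approx_normal_ip\<close>; one factor \<open>sqn w\<close> then cancels.\<close>

lemma approx_normal_sqn_diff: "sqn (g m - g n) \<le> 2 * ((sqn (g m) - 1) + (sqn (g n) - 1))"
proof -
  define w where "w = g m - g n"
  have w: "w \<in> V" using g by (simp add: approx_normal_def w_def)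
  define a where "a = cmod (ip (g m) w)"
  define b where "b = cmod (ip (g n) w)"
  have "sqn w = Re (ip (g m) w - ip (g n) w)" by (simp add: sqn_def w_def ip_diff_left)
  also have "\<dots> \<le> a + b"
    unfolding a_def b_def using complex_Re_le_cmod norm_triangle_ineq4 order_trans by blast
  finally have "(sqn w)\<^sup>2 \<le> (a + b)\<^sup>2" by (simp add: power_mono)
  also have "\<dots> \<le> 2 * (a\<^sup>2 + b\<^sup>2)" using sum_squares_bound[of a b] by (simp add: power2_sum)
  also have "\<dots> \<le> 2 * ((sqn (g m) - 1) + (sqn (g n) - 1)) * sqn w"
    using approx_normal_ip[OF w, of m] approx_normal_ip[OF w, of n]
    by (simp add: a_def b_def algebra_simps)
  finally have *: "sqn w * sqn w \<le> 2 * ((sqn (g m) - 1) + (sqn (g n) - 1)) * sqn w"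
    by (simp add: power2_eq_square)
  show ?thesis
  proof (cases "sqn w = 0")
    case True
    then show ?thesis
      using approx_normal_sqn_ge[of m] approx_normal_sqn_ge[of n] by (simp add: w_def)
  next
    case False
    then have "sqn w > 0" using sqn_nonneg[of w] by linarith
    then show ?thesis using * by (simp add: w_def)
  qed
qed

lemma approx_normal_cauchy_seq: "cauchy_seq g"
  unfolding cauchy_seq_def
proof (intro allI impI)
  fix e :: real assume e: "e > 0"
  then have "\<forall>\<^sub>F n in sequentially. sqn (g n) < 1 + e / 4"
    by (intro order_tendstoD(2)[OF approx_normal_sqn]) simp
  then obtain N where N: "\<And>n. n \<ge> N \<Longrightarrow> sqn (g n) < 1 + e / 4"
    by (auto simp: eventually_sequentially)
  have "sqn (g m - g n) < e" if "m \<ge> N" "n \<ge> N" for m n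
    using approx_normal_sqn_diff[of m n] N[OF that(1)] N[OF that(2)] by simp
  then show "\<exists>N. \<forall>m\<ge>N. \<forall>n\<ge>N. sqn (g m - g n) < e" by blast
qed

text \<open>The vector may vary with \<open>n\<close>, since earlier basis vectors are themselves
  only given by sequences.\<close>

lemma approx_normal_ip_seq:
  assumes w: "\<And>n. w n \<in> V" and B: "\<And>n. sqn (w n) \<le> B"
  shows "(\<lambda>n. ip (g n) (w n)) \<longlonglongrightarrow> 0"
proof -
  have "(\<lambda>n. (sqn (g n) - 1) * B) \<longlonglongrightarrow> (1 - 1) * B"
    by (intro tendsto_intros approx_normal_sqn)
  then have lim: "(\<lambda>n. (sqn (g n) - 1) * B) \<longlonglongrightarrow> 0" by simp
  have "(cmod (ip (g n) (w n)))\<^sup>2 \<le> (sqn (g n) - 1) * B" for n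
    using approx_normal_ip[OF w, of n n] mult_left_mono[OF B, of "sqn (g n) - 1" n]
      approx_normal_sqn_ge[of n] by simp
  then have "(\<lambda>n. (cmod (ip (g n) (w n)))\<^sup>2) \<longlonglongrightarrow> 0"
    by (intro tendsto_sandwich[OF _ _ tendsto_const lim]) auto
  then have "(\<lambda>n. sqrt ((cmod (ip (g n) (w n)))\<^sup>2)) \<longlonglongrightarrow> sqrt 0"
    by (rule tendsto_real_sqrt)
  then show ?thesis by (simp add: tendsto_norm_zero_iff)
qed

text \<open>Split \<open>g m\<close> as \<open>g n\<close> plus a bounded element of
  \<open>V\<close>. It follows later that each single \<open>g m\<close> has coordinate exactly 1,
  not only in the limit.\<close>

lemma approx_normal_ip_self: "(\<lambda>n. ip (g n) (g m)) \<longlonglongrightarrow> 1"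
proof -
  obtain B where B: "\<And>n. sqn (g n) \<le> B"
    using convergent_imp_Bseq[OF convergentI[OF approx_normal_sqn]] unfolding Bseq_def
    by (auto simp: abs_le_iff)
  have "(\<lambda>n. ip (g n) (g m - g n)) \<longlonglongrightarrow> 0"
  proof (rule approx_normal_ip_seq)
    show "g m - g n \<in> V" for n using g by (simp add: approx_normal_def)
    show "sqn (g m - g n) \<le> 4 * B" for n
      using approx_normal_sqn_diff[of m n] B[of m] B[of n] by simp
  qed
  then have "(\<lambda>n. complex_of_real (sqn (g n)) + ip (g n) (g m - g n)) \<longlonglongrightarrow> complex_of_real 1 + 0"
    by (intro tendsto_add tendsto_of_real approx_normal_sqn)
  then show ?thesis by (simp add: ip_diff_right flip: ip_self)
qed

end

text \<open>Without completeness a nearest point of \<open>V\<close> need not exist; a minimising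
  sequence replaces the orthogonal projection.\<close>

lemma exists_minimizing:
  assumes V: "subspace V"
  obtains v D where "\<And>n. v n \<in> V" "(\<lambda>n. sqn (x - v n)) \<longlonglongrightarrow> D" "0 \<le> D"
    "\<And>w. w \<in> V \<Longrightarrow> D \<le> sqn (x - w)"
proof -
  define S where "S = (\<lambda>w. sqn (x - w)) ` V"
  have S: "S \<noteq> {}" "bdd_below S" using subspace_0[OF V] by (auto simp: S_def intro: bdd_belowI[of _ 0])
  have le: "Inf S \<le> sqn (x - w)" if "w \<in> V" for w
    using S that by (intro cInf_lower) (auto simp: S_def)
  have "\<exists>w\<in>V. sqn (x - w) < Inf S + 1 / real (Suc n)" for n
    using cInf_lessD[OF S(1), of "Inf S + 1 / real (Suc n)"] by (auto simp: S_def)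
  then obtain v where v: "\<And>n. v n \<in> V" "\<And>n. sqn (x - v n) < Inf S + 1 / real (Suc n)"
    by metis
  have "(\<lambda>n. Inf S + 1 / real (Suc n)) \<longlonglongrightarrow> Inf S + 0"
    by (intro tendsto_intros) (rule LIMSEQ_inverse_real_of_nat[unfolded inverse_eq_divide])
  then have up: "(\<lambda>n. Inf S + 1 / real (Suc n)) \<longlonglongrightarrow> Inf S" by simp
  have "(\<lambda>n. sqn (x - v n)) \<longlonglongrightarrow> Inf S"
    by (rule tendsto_sandwich[OF _ _ tendsto_const up]) (use v le in \<open>auto intro!: always_eventually less_imp_le\<close>)
  moreover have "0 \<le> Inf S" using S by (intro cInf_greatest) (auto simp: S_def)
  ultimately show thesis by (rule that[OF v(1) _ _ le])
qed

end

text \<open>The sequence \<open>g i\<close> represents the \<open>i\<close>-th vector of an orthonormal system in the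
  completion, and \<open>f i\<close> is the \<open>i\<close>-th coordinate.\<close>

locale approx_orthonormal = complex_semi_inner scale ip
  for scale :: "complex \<Rightarrow> 'v::ab_group_add \<Rightarrow> 'v" (infixr \<open>*s\<close> 75) and ip +
  fixes I :: "'i set" and g :: "'i \<Rightarrow> nat \<Rightarrow> 'v" and f :: "'i \<Rightarrow> 'v \<Rightarrow> complex"
  assumes g_cauchy: "i \<in> I \<Longrightarrow> cauchy_seq (g i)"
    and g_ortho: "i \<in> I \<Longrightarrow> j \<in> I \<Longrightarrow> (\<lambda>n. ip (g i n) (g j n)) \<longlonglongrightarrow> (if i = j then 1 else 0)"
    and f_lim: "i \<in> I \<Longrightarrow> (\<lambda>n. ip (g i n) x) \<longlonglongrightarrow> f i x"
    and f_g: "i \<in> I \<Longrightarrow> f i (g i n) = 1"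
begin

text \<open>The coordinate vector, cut off because \<open>f i\<close> is constrained only for
  \<open>i\<close> in \<open>I\<close>.\<close>

definition J :: "'v \<Rightarrow> 'i \<Rightarrow> complex" where
  "J x = (\<lambda>i. if i \<in> I then f i x else 0)"

lemma f_add: "i \<in> I \<Longrightarrow> f i (x + y) = f i x + f i y"
  using tendsto_add[OF f_lim[of i x] f_lim[of i y]]
  by (intro LIMSEQ_unique[OF f_lim]) (simp_all add: ip_add_right)

lemma f_scale: "i \<in> I \<Longrightarrow> f i (c *s x) = c * f i x"
  using tendsto_mult[OF tendsto_const[of c] f_lim[of i x]]
  by (intro LIMSEQ_unique[OF f_lim]) (simp_all add: ip_scale_right)

lemma J_add: "J (x + y) = (\<lambda>i. J x i + J y i)"
  by (auto simp: J_def f_add)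

lemma J_scale: "J (c *s x) = (\<lambda>i. c * J x i)"
  by (auto simp: J_def f_scale)

definition comb :: "'i set \<Rightarrow> ('i \<Rightarrow> complex) \<Rightarrow> nat \<Rightarrow> 'v" where
  "comb F c n = (\<Sum>i\<in>F. c i *s g i n)"

lemma comb_ip:
  assumes "F \<subseteq> I"
  shows "(\<lambda>n. ip (comb F c n) x) \<longlonglongrightarrow> (\<Sum>i\<in>F. cnj (c i) * f i x)"
  unfolding comb_def ip_sum_left ip_scale_left
  by (intro tendsto_intros f_lim) (use assms in auto)

lemma comb_sqn:
  assumes F: "finite F" "F \<subseteq> I"
  shows "(\<lambda>n. sqn (comb F c n)) \<longlonglongrightarrow> (\<Sum>i\<in>F. (cmod (c i))\<^sup>2)"
proof -
  have "(\<lambda>n. ip (comb F c n) (comb F c n))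
      \<longlonglongrightarrow> (\<Sum>i\<in>F. \<Sum>j\<in>F. c i * (cnj (c j) * (if j = i then 1 else 0)))"
    unfolding comb_def ip_sum_left ip_scale_left ip_sum_right ip_scale_right sum_distrib_left
    by (intro tendsto_intros g_ortho) (use F in auto)
  also have "(\<Sum>i\<in>F. \<Sum>j\<in>F. c i * (cnj (c j) * (if j = i then 1 else 0)))
      = complex_of_real (\<Sum>i\<in>F. (cmod (c i))\<^sup>2)"
    using F by (simp add: if_distrib complex_norm_square sum.delta del: of_real_power cong: if_cong)
  finally show ?thesis using tendsto_Re by (force simp: sqn_def)
qed

text \<open>Pythagoras for the finite Fourier expansion; nonnegativity of the limit is Bessel's
  inequality.\<close>

lemma residual_sqn:
  assumes F: "finite F" "F \<subseteq> I"
  shows "(\<lambda>n. sqn (x - comb F (\<lambda>i. f i x) n)) \<longlonglongrightarrow> sqn x - (\<Sum>i\<in>F. (cmod (f i x))\<^sup>2)"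
proof -
  have "(\<lambda>n. sqn (x - comb F (\<lambda>i. f i x) n)) \<longlonglongrightarrow>
    sqn x - 2 * Re (\<Sum>i\<in>F. cnj (f i x) * f i x) + (\<Sum>i\<in>F. (cmod (f i x))\<^sup>2)"
    unfolding sqn_diff by (intro tendsto_intros comb_ip comb_sqn F)
  also have "(\<Sum>i\<in>F. cnj (f i x) * f i x) = complex_of_real (\<Sum>i\<in>F. (cmod (f i x))\<^sup>2)"
    by (simp only: of_real_sum complex_norm_square mult.commute)
  finally show ?thesis by simp
qed

lemma bessel_finite:
  assumes "finite F" "F \<subseteq> I"
  shows "(\<Sum>i\<in>F. (cmod (f i x))\<^sup>2) \<le> sqn x"
  using LIMSEQ_le_const[OF residual_sqn[OF assms, of x], of 0] by auto

lemma f_summable: "(\<lambda>i. (cmod (f i x))\<^sup>2) summable_on I"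
  by (rule nonneg_bdd_above_summable_on) (auto intro!: bdd_aboveI[of _ "sqn x"] bessel_finite)

lemma J_l2: "J x \<in> l2 I"
proof -
  have "(\<lambda>i. (cmod (J x i))\<^sup>2) summable_on I \<longleftrightarrow> (\<lambda>i. (cmod (f i x))\<^sup>2) summable_on I"
    by (rule summable_on_cong) (simp add: J_def)
  then show ?thesis using f_summable by (simp add: l2_def J_def)
qed

lemma l2_norm_J: "(l2_norm I (J x))\<^sup>2 = infsum (\<lambda>i. (cmod (f i x))\<^sup>2) I"
  unfolding l2_norm_power2 by (rule infsum_cong) (simp add: J_def)

lemma bessel: "(l2_norm I (J x))\<^sup>2 \<le> sqn x"
  unfolding l2_norm_J by (intro infsum_le_finite_sums f_summable bessel_finite)

lemma bessel_single:
  assumes "i \<in> I"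
  shows "(cmod (f i x))\<^sup>2 \<le> (l2_norm I (J x))\<^sup>2"
  unfolding l2_norm_J using finite_sum_le_infsum[OF f_summable, of "{i}"] assms by simp

text \<open>The inner product of the components orthogonal to the orthonormal system. Bessel makes
  it a semi-inner product, so its null vectors form a subspace, and Parseval says that every vector
  is null.\<close>

definition defect :: "'v \<Rightarrow> 'v \<Rightarrow> complex" where
  "defect x y = ip x y - l2_inner I (J x) (J y)"

lemma defect_self: "Re (defect x x) = sqn x - (l2_norm I (J x))\<^sup>2"
  by (simp add: defect_def sqn_def l2_inner_self[OF J_l2])

lemma complex_semi_inner_defect: "complex_semi_inner scale defect"
proof unfold_locales
  show "0 \<le> Re (defect x x)" for x using bessel by (simp add: defect_self)
  show "cnj (defect x y) = defect y x" for x y by (simp add: defect_def ip_cnj l2_inner_cnj)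
qed (simp_all add: defect_def ip_add_right ip_scale_right J_add J_scale J_l2 l2_inner_add_right
      l2_inner_scale_right algebra_simps)

lemma defect_null:
  assumes "Re (defect y y) = 0"
  shows "defect x y = 0"
  using complex_semi_inner.cauchy_schwarz[OF complex_semi_inner_defect, of x y] assms
  by (simp add: complex_semi_inner.sqn_def[OF complex_semi_inner_defect])

lemma subspace_defect: "subspace {x. Re (defect x x) = 0}"
proof -
  interpret D: complex_semi_inner scale defect by (rule complex_semi_inner_defect)
  show ?thesis
    by (rule subspaceI) (auto simp: D.ip_add_right D.ip_scale_right defect_null)
qed

lemma defect_diff:
  assumes "Re (defect y y) = 0"
  shows "Re (defect (x - y) (x - y)) = Re (defect x x)"
proof -
  interpret D: complex_semi_inner scale defect by (rule complex_semi_inner_defect)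
  have "defect y x = 0" using defect_null[OF assms, of x] D.ip_cnj[of x y] by simp
  then show ?thesis by (simp add: D.ip_diff_right D.ip_diff_left defect_null[OF assms])
qed

end

locale approx_basis = approx_orthonormal scale ip I g f
  for scale :: "complex \<Rightarrow> 'v::ab_group_add \<Rightarrow> 'v" (infixr \<open>*s\<close> 75) and ip
    and I :: "'i set" and g :: "'i \<Rightarrow> nat \<Rightarrow> 'v" and f :: "'i \<Rightarrow> 'v \<Rightarrow> complex" +
  assumes parseval: "(l2_norm I (J x))\<^sup>2 = sqn x"

text \<open>Gram--Schmidt along a well-order of \<open>'i\<close>: the \<open>i\<close>-th vector is the normalised component
  of \<open>u i\<close> orthogonal to the span of its predecessors, if this component is nonzero.\<close>

theorem (in complex_semi_inner) exists_approx_basis: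
  fixes u :: "'i \<Rightarrow> 'v"
  assumes u: "surj u"
  obtains I :: "'i set" and g f where "approx_basis scale ip I g f"
proof -
  obtain r :: "'i rel" where "well_order_on UNIV r" using well_order_on by blast
  define lt where "lt = r - Id"
  have wf: "wf lt" and tot: "\<And>i j. i \<noteq> j \<Longrightarrow> (i, j) \<in> lt \<or> (j, i) \<in> lt" and "trans lt"
    using \<open>well_order_on UNIV r\<close> unfolding lt_def
    by (auto simp: well_order_on_def linear_order_on_def partial_order_on_def preorder_on_def
        total_on_def intro: trans_diff_Id)
  define V where "V i = span (u ` {j. (j, i) \<in> lt})" for i
  have sV: "subspace (V i)" for i by (simp add: V_def)
  have uV: "u j \<in> V i" if "(j, i) \<in> lt" for i j
    using that by (auto simp: V_def intro!: span_base)
  have V_mono: "V j \<subseteq> V i" if "(j, i) \<in> lt" for i j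
    unfolding V_def using that \<open>trans lt\<close> by (intro span_mono) (auto dest: transD)
  have "\<exists>v D. (\<forall>n. v n \<in> V i) \<and> (\<lambda>n. sqn (u i - v n)) \<longlonglongrightarrow> D \<and> 0 \<le> D
      \<and> (\<forall>w\<in>V i. D \<le> sqn (u i - w))" for i
    using exists_minimizing[OF sV] by metis
  then obtain v D where v: "\<And>i n. v i n \<in> V i" and lim: "\<And>i. (\<lambda>n. sqn (u i - v i n)) \<longlonglongrightarrow> D i"
    and D0: "\<And>i. 0 \<le> D i" and D: "\<And>i w. w \<in> V i \<Longrightarrow> D i \<le> sqn (u i - w)"
    by metis
  \<comment> \<open>Indices with \<open>D i = 0\<close> are dropped: there \<open>u i\<close> is
    already a limit of elements of \<open>V i\<close>.\<close>
  define I where "I = {i. D i > 0}"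
  define k where "k i = complex_of_real (sqrt (D i))" for i
  define g where "g i n = (1 / k i) *s (u i - v i n)" for i n
  have k: "k i \<noteq> 0" "(cmod (1 / k i))\<^sup>2 = 1 / D i" "(cmod (k i))\<^sup>2 = D i" if "i \<in> I" for i
    using that by (simp_all add: I_def k_def norm_divide power_divide)
  have kg: "u i - v i n = k i *s g i n" if "i \<in> I" for i n
    using k(1)[OF that] by (simp add: g_def)
  have normal: "approx_normal (V i) (g i)" if i: "i \<in> I" for i
    unfolding approx_normal_def
  proof (intro conjI allI ballI)
    have "g i m - g i n = (1 / k i) *s (v i n - v i m)" for m n
      by (simp add: g_def algebra_simps)
    then show "g i m - g i n \<in> V i" for m n
      using subspace_scale[OF sV subspace_diff[OF sV v v]] by simp
    have "(\<lambda>n. 1 / D i * sqn (u i - v i n)) \<longlonglongrightarrow> 1 / D i * D i"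
      by (intro tendsto_intros lim)
    then show "(\<lambda>n. sqn (g i n)) \<longlonglongrightarrow> 1"
      using i k[OF i] by (simp add: g_def sqn_scale I_def)
    fix n w assume w: "w \<in> V i"
    have "g i n + w = (1 / k i) *s (u i - (v i n - k i *s w))"
      using k(1)[OF i] by (simp add: g_def algebra_simps)
    moreover have "D i \<le> sqn (u i - (v i n - k i *s w))"
      using w by (intro D subspace_diff[OF sV] v subspace_scale[OF sV])
    ultimately show "1 \<le> sqn (g i n + w)"
      using i k[OF i] by (simp add: sqn_scale I_def)
  qed
  have gV: "g j n \<in> V i" if "(j, i) \<in> lt" for i j n
    unfolding g_def using V_mono[OF that] uV[OF that] v[of j n]
    by (intro subspace_scale[OF sV] subspace_diff[OF sV]) auto
  define f where "f i x = lim (\<lambda>n. ip (g i n) x)" for i x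
  have flim: "(\<lambda>n. ip (g i n) x) \<longlonglongrightarrow> f i x" if "i \<in> I" for i x
  proof -
    have "convergent (\<lambda>n. ip (g i n) x)"
      using cauchy_schwarz_sqrt[of _ x]
      by (intro cauchy_seq_convergent[OF approx_normal_cauchy_seq[OF sV normal[OF that]],
            of "\<lambda>y. ip y x" "sqrt (sqn x)"]) (simp_all add: ip_diff_left mult.commute)
    then show ?thesis by (simp add: f_def convergent_LIMSEQ_iff)
  qed
  have less: "(\<lambda>n. ip (g i n) (g j n)) \<longlonglongrightarrow> 0" if ij: "i \<in> I" "j \<in> I" "(j, i) \<in> lt" for i j
  proof -
    obtain B where "\<And>n. sqn (g j n) \<le> B"
      using convergent_imp_Bseq[OF convergentI[OF approx_normal_sqn[OF sV normal[OF ij(2)]]]]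
      unfolding Bseq_def by (auto simp: abs_le_iff)
    then show ?thesis by (intro approx_normal_ip_seq[OF sV normal[OF ij(1)] gV[OF ij(3)]])
  qed
  interpret B: approx_orthonormal scale ip I g f
  proof unfold_locales
    fix i j assume ij: "i \<in> I" "j \<in> I"
    show "cauchy_seq (g i)" by (rule approx_normal_cauchy_seq[OF sV normal[OF ij(1)]])
    show "f i (g i n) = 1" for n
      by (rule LIMSEQ_unique[OF flim[OF ij(1)] approx_normal_ip_self[OF sV normal[OF ij(1)]]])
    show "(\<lambda>n. ip (g i n) x) \<longlonglongrightarrow> f i x" for x by (rule flim[OF ij(1)])
    consider "i = j" | "(j, i) \<in> lt" | "(i, j) \<in> lt" using tot by blast
    then show "(\<lambda>n. ip (g i n) (g j n)) \<longlonglongrightarrow> (if i = j then 1 else 0)"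
    proof cases
      case 1
      then show ?thesis
        using tendsto_of_real[OF approx_normal_sqn[OF sV normal[OF ij(1)]], where 'a = complex]
        by (simp add: ip_self)
    next
      case 2
      then show ?thesis using less[OF ij 2] wf by auto
    next
      case 3
      then show ?thesis using tendsto_cnj[OF less[OF ij(2,1) 3]] wf by (auto simp: ip_cnj)
    qed
  qed
  \<comment> \<open>By induction all of \<open>V i\<close> is null for the defect, so subtracting
    \<open>v i n\<close> does not change the defect of \<open>u i\<close>. The remainder has squared
    norm tending to \<open>D i\<close>, and if \<open>D i > 0\<close> its i-th coordinate alone
    already accounts for \<open>D i\<close>; hence the defect is 0.\<close>
  have null: "Re (B.defect (u i) (u i)) = 0" for i
    using wf
  proof (induction i rule: wf_induct_rule)
    case (less i)
    have "V i \<subseteq> {x. Re (B.defect x x) = 0}"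
      unfolding V_def using less by (intro span_minimal B.subspace_defect) auto
    then have "Re (B.defect (u i) (u i)) = Re (B.defect (u i - v i n) (u i - v i n))" for n
      using v[of i n] by (subst B.defect_diff) auto
    also have "Re (B.defect (u i - v i n) (u i - v i n)) \<le> sqn (u i - v i n) - D i" for n
    proof (cases "i \<in> I")
      case True
      have "(cmod (f i (u i - v i n)))\<^sup>2 = D i"
        unfolding kg[OF True] by (simp add: B.f_scale B.f_g True k)
      then show ?thesis using B.bessel_single[OF True, of "u i - v i n"] by (simp add: B.defect_self)
    next
      case False
      then have "D i = 0" using D0[of i] by (simp add: I_def)
      then show ?thesis by (simp add: B.defect_self)
    qed
    finally have "Re (B.defect (u i) (u i)) \<le> sqn (u i - v i n) - D i" for n .
    then have "Re (B.defect (u i) (u i)) \<le> D i - D i"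
      by (intro LIMSEQ_le_const[OF tendsto_diff[OF lim tendsto_const]]) auto
    then show ?case using B.bessel[of "u i"] by (simp add: B.defect_self)
  qed
  have "approx_basis scale ip I g f"
  proof unfold_locales
    fix x
    obtain i where "x = u i" using u by blast
    then show "(l2_norm I (B.J x))\<^sup>2 = sqn x" using null[of i] by (simp add: B.defect_self)
  qed
  then show thesis by (rule that)
qed

section \<open>Operators from bounded sesquilinear forms\<close>

definition l2_conv :: "'i set \<Rightarrow> (nat \<Rightarrow> 'i \<Rightarrow> complex) \<Rightarrow> ('i \<Rightarrow> complex) \<Rightarrow> bool" where
  "l2_conv I a b \<longleftrightarrow> (\<forall>n. a n \<in> l2 I) \<and> b \<in> l2 I \<and> (\<lambda>n. l2_norm I (\<lambda>i. a n i - b i)) \<longlonglongrightarrow> 0"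

lemma l2_conv_const: "a \<in> l2 I \<Longrightarrow> l2_conv I (\<lambda>_. a) a"
  by (simp add: l2_conv_def l2_norm_def)

lemma l2_conv_inner:
  assumes a: "l2_conv I a a'" and b: "l2_conv I b b'"
  shows "(\<lambda>n. l2_inner I (a n) (b n)) \<longlonglongrightarrow> l2_inner I a' b'"
proof -
  define A where "A = (\<lambda>n. l2_norm I (\<lambda>i. a n i - a' i))"
  define B where "B = (\<lambda>n. l2_norm I (\<lambda>i. b n i - b' i))"
  have l2: "a n \<in> l2 I" "a' \<in> l2 I" "b n \<in> l2 I" "b' \<in> l2 I" for n
    using a b by (auto simp: l2_conv_def)
  have lim: "A \<longlonglongrightarrow> 0" "B \<longlonglongrightarrow> 0" using a b by (auto simp: l2_conv_def A_def B_def)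
  have "cmod (l2_inner I (a n) (b n) - l2_inner I a' b')
      \<le> A n * (B n + l2_norm I b') + l2_norm I a' * B n" for n
  proof -
    have eq: "l2_inner I (a n) (b n) - l2_inner I a' b'
        = l2_inner I (\<lambda>i. a n i - a' i) (b n) + l2_inner I a' (\<lambda>i. b n i - b' i)"
      by (simp add: l2_inner_diff_left l2_inner_diff_right l2)
    have "cmod (l2_inner I (\<lambda>i. a n i - a' i) (b n)) \<le> A n * l2_norm I (b n)"
      unfolding A_def by (intro l2_cauchy_schwarz l2_diff l2)
    moreover have "cmod (l2_inner I a' (\<lambda>i. b n i - b' i)) \<le> l2_norm I a' * B n"
      unfolding B_def by (intro l2_cauchy_schwarz l2_diff l2)
    moreover have "l2_norm I (b n) \<le> B n + l2_norm I b'"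
      using l2_norm_triangle[OF l2_diff[OF l2(3,4)] l2(4), of n] by (simp add: B_def)
    then have "A n * l2_norm I (b n) \<le> A n * (B n + l2_norm I b')"
      by (rule mult_left_mono) (simp add: A_def)
    ultimately show ?thesis
      unfolding eq using norm_triangle_ineq[of "l2_inner I (\<lambda>i. a n i - a' i) (b n)"
          "l2_inner I a' (\<lambda>i. b n i - b' i)"] by linarith
  qed
  note bound = this
  have "(\<lambda>n. A n * (B n + l2_norm I b') + l2_norm I a' * B n)
      \<longlonglongrightarrow> 0 * (0 + l2_norm I b') + l2_norm I a' * 0"
    by (intro tendsto_intros lim)
  then have up: "(\<lambda>n. A n * (B n + l2_norm I b') + l2_norm I a' * B n) \<longlonglongrightarrow> 0" by simp
  have "(\<lambda>n. cmod (l2_inner I (a n) (b n) - l2_inner I a' b')) \<longlonglongrightarrow> 0"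
    by (rule tendsto_sandwich[OF _ _ tendsto_const up]) (use bound in \<open>auto intro: always_eventually\<close>)
  then have "(\<lambda>n. l2_inner I (a n) (b n) - l2_inner I a' b') \<longlonglongrightarrow> 0"
    by (rule tendsto_norm_zero_cancel)
  then show ?thesis by (simp add: LIM_zero_iff)
qed

lemma l2_conv_bop:
  assumes T: "T \<in> bop I" and a: "l2_conv I a b"
  shows "l2_conv I (\<lambda>n. T (a n)) (T b)"
proof -
  obtain K where K: "\<And>x. x \<in> l2 I \<Longrightarrow> l2_norm I (T x) \<le> K * l2_norm I x"
    using bop_bounded[OF T] by blast
  have l2: "a n \<in> l2 I" "b \<in> l2 I" for n using a by (auto simp: l2_conv_def)
  have lim: "(\<lambda>n. l2_norm I (\<lambda>i. a n i - b i)) \<longlonglongrightarrow> 0" using a by (simp add: l2_conv_def)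
  have "(\<lambda>n. K * l2_norm I (\<lambda>i. a n i - b i)) \<longlonglongrightarrow> K * 0" by (intro tendsto_intros lim)
  then have up: "(\<lambda>n. K * l2_norm I (\<lambda>i. a n i - b i)) \<longlonglongrightarrow> 0" by simp
  have "l2_norm I (\<lambda>i. T (a n) i - T b i) \<le> K * l2_norm I (\<lambda>i. a n i - b i)" for n
    using K[OF l2_diff[OF l2]] by (simp add: bop_diff[OF T l2])
  then have "(\<lambda>n. l2_norm I (\<lambda>i. T (a n) i - T b i)) \<longlonglongrightarrow> 0"
    by (intro tendsto_sandwich[OF always_eventually always_eventually tendsto_const up]) auto
  then show ?thesis using l2 by (simp add: l2_conv_def bop_l2[OF T])
qed

lemma unit_vector_has_sum:
  fixes h :: "'i \<Rightarrow> 'b::{comm_monoid_add, topological_space}"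
  assumes "i \<in> I"
  shows "((\<lambda>j. if j = i then h j else 0) has_sum h i) I"
  using has_sum_finite_neutralI[of "{i}" I "\<lambda>j. if j = i then h j else 0" "h i"] assms by simp

context approx_basis
begin

text \<open>Parseval kills the defect on the diagonal, and Cauchy-Schwarz for the defect kills it
  elsewhere.\<close>

lemma l2_inner_J: "l2_inner I (J x) (J y) = ip x y"
proof -
  have "defect x y = 0" by (rule defect_null) (simp add: defect_self parseval)
  then show ?thesis by (simp add: defect_def)
qed

lemma l2_norm_J_eq: "l2_norm I (J x) = sqrt (sqn x)"
  using parseval[of x] by (simp add: real_sqrt_unique)

lemma f_has_sum: "((\<lambda>i. (cmod (f i x))\<^sup>2) has_sum sqn x) I"
  using has_sum_infsum[OF f_summable] by (simp flip: parseval add: l2_norm_J)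

text \<open>The coordinates of \<open>t\<close> are the limits of \<open>F (g i n)\<close>. Testing
  \<open>F\<close> on combinations with coefficients \<open>t\<close> itself gives square
  summability with bound \<open>C\<close>; the error of a finite expansion of \<open>x\<close> is at
  most \<open>C\<close> times the root of its Parseval residual.\<close>

lemma riesz:
  fixes F :: "'v \<Rightarrow> complex"
  assumes add: "\<And>x y. F (x + y) = F x + F y" and scale: "\<And>c x. F (c *s x) = cnj c * F x"
    and bound: "\<And>x. cmod (F x) \<le> C * sqrt (sqn x)" and C: "0 \<le> C"
  obtains t where "t \<in> l2 I" "\<And>x. l2_inner I (J x) t = F x" "l2_norm I t \<le> C"
proof -
  have diff: "F (x - y) = F x - F y" for x y using add[of "x - y" y] by simp
  have zero: "F 0 = 0" using diff[of 0 0] by simp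
  have sum: "F (\<Sum>i\<in>A. h i) = (\<Sum>i\<in>A. F (h i))" for A :: "'c set" and h
    by (induction A rule: infinite_finite_induct) (simp_all add: zero add)
  define t where "t i = (if i \<in> I then lim (\<lambda>n. F (g i n)) else 0)" for i
  have t: "(\<lambda>n. F (g i n)) \<longlonglongrightarrow> t i" if "i \<in> I" for i
    using cauchy_seq_convergent[OF g_cauchy[OF that] diff bound] that
    by (simp add: t_def convergent_LIMSEQ_iff)
  have Fcomb: "(\<lambda>n. F (comb A c n)) \<longlonglongrightarrow> (\<Sum>i\<in>A. cnj (c i) * t i)" if "A \<subseteq> I" for A c
    unfolding comb_def sum scale by (intro tendsto_intros t) (use that in auto)
  have finite_bound: "(\<Sum>i\<in>A. (cmod (t i))\<^sup>2) \<le> C\<^sup>2" if A: "finite A" "A \<subseteq> I" for A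
  proof -
    define S where "S = (\<Sum>i\<in>A. (cmod (t i))\<^sup>2)"
    have S: "S \<ge> 0" by (simp add: S_def sum_nonneg)
    have "cmod (\<Sum>i\<in>A. cnj (t i) * t i) \<le> C * sqrt S"
    proof (rule LIMSEQ_le)
      show "(\<lambda>n. cmod (F (comb A t n))) \<longlonglongrightarrow> cmod (\<Sum>i\<in>A. cnj (t i) * t i)"
        by (intro tendsto_norm Fcomb A)
      show "(\<lambda>n. C * sqrt (sqn (comb A t n))) \<longlonglongrightarrow> C * sqrt S"
        unfolding S_def by (intro tendsto_intros comb_sqn A)
    qed (use bound in blast)
    also have "(\<Sum>i\<in>A. cnj (t i) * t i) = complex_of_real S"
      unfolding S_def by (simp only: of_real_sum complex_norm_square mult.commute)
    finally have "sqrt S * sqrt S \<le> C * sqrt S" using S by simp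
    then have "sqrt S \<le> C" using S C mult_right_le_imp_le[of "sqrt S" "sqrt S" C] by (cases "S = 0") auto
    then have "(sqrt S)\<^sup>2 \<le> C\<^sup>2" using S by (intro power_mono) auto
    then show ?thesis using S by (simp add: S_def)
  qed
  have t_sum: "(\<lambda>i. (cmod (t i))\<^sup>2) summable_on I"
    by (rule nonneg_bdd_above_summable_on) (auto intro!: bdd_aboveI[of _ "C\<^sup>2"] finite_bound)
  then have tl2: "t \<in> l2 I" by (simp add: l2_def t_def)
  have "l2_norm I t \<le> C"
    unfolding l2_norm_def using C
    by (intro real_le_lsqrt infsum_le_finite_sums t_sum finite_bound) (auto simp: infsum_nonneg)
  moreover have "l2_inner I (J x) t = F x" for x
  proof -
    let ?fin = "finite_subsets_at_top I"
    have approx: "cmod (F x - (\<Sum>i\<in>A. cnj (J x i) * t i))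
        \<le> C * sqrt (sqn x - (\<Sum>i\<in>A. (cmod (f i x))\<^sup>2))" if A: "finite A" "A \<subseteq> I" for A
    proof (rule LIMSEQ_le)
      have "(\<Sum>i\<in>A. cnj (J x i) * t i) = (\<Sum>i\<in>A. cnj (f i x) * t i)"
        using A by (intro sum.cong) (auto simp: J_def)
      then show "(\<lambda>n. cmod (F (x - comb A (\<lambda>i. f i x) n)))
          \<longlonglongrightarrow> cmod (F x - (\<Sum>i\<in>A. cnj (J x i) * t i))"
        unfolding diff by (auto intro!: tendsto_intros Fcomb A)
      show "(\<lambda>n. C * sqrt (sqn (x - comb A (\<lambda>i. f i x) n)))
          \<longlonglongrightarrow> C * sqrt (sqn x - (\<Sum>i\<in>A. (cmod (f i x))\<^sup>2))"
        by (intro tendsto_intros residual_sqn A)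
    qed (use bound in blast)
    have "cmod (F x - l2_inner I (J x) t) \<le> C * sqrt (sqn x - sqn x)"
    proof (rule tendsto_le[where F = ?fin])
      have "((\<lambda>i. cnj (J x i) * t i) has_sum l2_inner I (J x) t) I"
        unfolding l2_inner_def by (intro has_sum_infsum l2_inner_summable J_l2 tl2)
      then show "((\<lambda>A. cmod (F x - (\<Sum>i\<in>A. cnj (J x i) * t i)))
          \<longlongrightarrow> cmod (F x - l2_inner I (J x) t)) ?fin"
        unfolding has_sum_def by (intro tendsto_intros)
      show "((\<lambda>A. C * sqrt (sqn x - (\<Sum>i\<in>A. (cmod (f i x))\<^sup>2)))
          \<longlongrightarrow> C * sqrt (sqn x - sqn x)) ?fin"
        using f_has_sum[of x] unfolding has_sum_def by (intro tendsto_intros)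
      show "\<forall>\<^sub>F A in ?fin. cmod (F x - (\<Sum>i\<in>A. cnj (J x i) * t i))
          \<le> C * sqrt (sqn x - (\<Sum>i\<in>A. (cmod (f i x))\<^sup>2))"
        by (intro eventually_finite_subsets_at_top_weakI approx)
    qed simp
    then show ?thesis by simp
  qed
  ultimately show thesis using that tl2 by blast
qed

text \<open>The squared distance of \<open>J (g i n)\<close> from the unit vector \<open>e\<close>
  is \<open>1 - 2 + sqn (g i n)\<close>, because the i-th coordinate is exactly 1. So
  \<open>J (g i n)\<close> tends to \<open>e\<close> in norm.\<close>

lemma J_g_inner:
  assumes i: "i \<in> I" and h: "h \<in> l2 I"
  shows "(\<lambda>n. l2_inner I (J (g i n)) h) \<longlonglongrightarrow> h i"
proof -
  define e where "e j = (if j = i then 1 else 0 :: complex)" for j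
  have "(\<lambda>j. (cmod (e j))\<^sup>2) = (\<lambda>j. if j = i then 1 else 0)" by (auto simp: e_def)
  then have "((\<lambda>j. (cmod (e j))\<^sup>2) has_sum 1) I"
    using unit_vector_has_sum[OF i, of "\<lambda>_. 1 :: real"] by simp
  then have e: "e \<in> l2 I" "(l2_norm I e)\<^sup>2 = 1"
    unfolding l2_norm_power2 using i by (auto simp: l2_def e_def summable_on_def infsumI)
  have e_inner: "l2_inner I e k = k i" for k
  proof -
    have "(\<lambda>j. cnj (e j) * k j) = (\<lambda>j. if j = i then k j else 0)" by (auto simp: e_def)
    then show ?thesis
      unfolding l2_inner_def using unit_vector_has_sum[OF i, of k] by (simp add: infsumI)
  qed
  have "(l2_norm I (\<lambda>j. e j - J (g i n) j))\<^sup>2 = sqn (g i n) - 1" for n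
    using l2_norm_diff_power2[OF e(1) J_l2[of "g i n"]]
    by (simp add: e e_inner parseval) (simp add: J_def i f_g)
  then have norm: "l2_norm I (\<lambda>j. J (g i n) j - e j) = sqrt (sqn (g i n) - 1)" for n
    using l2_norm_scale[OF l2_diff[OF e(1) J_l2[of "g i n"]], of "- 1"]
    by (simp add: real_sqrt_unique[symmetric])
  have "(\<lambda>n. sqn (g i n)) \<longlonglongrightarrow> 1"
    using tendsto_Re[OF g_ortho[OF i i]] by (simp add: sqn_def)
  then have "(\<lambda>n. sqrt (sqn (g i n) - 1)) \<longlonglongrightarrow> sqrt (1 - 1)" by (intro tendsto_intros)
  then have "l2_conv I (\<lambda>n. J (g i n)) e" by (simp add: l2_conv_def J_l2 e norm)
  then show ?thesis using l2_conv_inner[OF _ l2_conv_const[OF h]] e_inner by metis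
qed

lemma J_separates:
  assumes h: "h \<in> l2 I" "k \<in> l2 I" and eq: "\<And>x. l2_inner I (J x) h = l2_inner I (J x) k"
  shows "h = k"
proof
  fix i
  show "h i = k i"
  proof (cases "i \<in> I")
    case True
    then show ?thesis
      using LIMSEQ_unique[OF J_g_inner[OF True h(1)]] J_g_inner[OF True h(2)] by (simp add: eq)
  next
    case False
    then show ?thesis using h by (simp add: l2_def)
  qed
qed

text \<open>Truncate \<open>h\<close> to a finite set \<open>A\<close> and imitate it by
  \<open>comb A h n\<close>: the squared distance tends to the tail of \<open>h\<close> outside
  \<open>A\<close>.\<close>

lemma J_dense:
  assumes h: "h \<in> l2 I"
  obtains xs where "l2_conv I (\<lambda>n. J (xs n)) h"
proof -
  have close: "\<exists>x. l2_norm I (\<lambda>i. J x i - h i) < e" if e: "e > 0" for e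
  proof -
    have hs: "((\<lambda>i. (cmod (h i))\<^sup>2) has_sum (l2_norm I h)\<^sup>2) I"
      unfolding l2_norm_power2 by (intro has_sum_infsum l2_summable h)
    obtain A where A: "finite A" "A \<subseteq> I"
        "dist (\<Sum>i\<in>A. (cmod (h i))\<^sup>2) ((l2_norm I h)\<^sup>2) \<le> e\<^sup>2 / 2"
      using has_sum_finite_approximation[OF hs, of "e\<^sup>2 / 2"] e by auto
    define S where "S = (\<Sum>i\<in>A. (cmod (h i))\<^sup>2)"
    have J_comb: "l2_inner I (J (comb A h n)) h = (\<Sum>i\<in>A. cnj (h i) * l2_inner I (J (g i n)) h)" for n
    proof -
      have "J (comb A h n) = (\<lambda>j. \<Sum>i\<in>A. h i * J (g i n) j)"
        unfolding comb_def using A(1)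
      proof (induction A)
        case empty
        then show ?case using J_scale[of 0 0] by simp
      qed (simp add: J_add J_scale)
      moreover have "l2_inner I (\<lambda>j. \<Sum>i\<in>A. h i * J (g i n) j) h
          = (\<Sum>i\<in>A. cnj (h i) * l2_inner I (J (g i n)) h)
          \<and> (\<lambda>j. \<Sum>i\<in>A. h i * J (g i n) j) \<in> l2 I"
        using A(1)
        by induction (simp_all add: l2_add l2_scale J_l2 l2_inner_add_left l2_inner_scale_left h)
      ultimately show ?thesis by simp
    qed
    have "(\<lambda>n. sqn (comb A h n) - 2 * Re (l2_inner I (J (comb A h n)) h) + (l2_norm I h)\<^sup>2)
        \<longlonglongrightarrow> S - 2 * Re (\<Sum>i\<in>A. cnj (h i) * h i) + (l2_norm I h)\<^sup>2"
      unfolding J_comb S_def by (intro tendsto_intros comb_sqn J_g_inner h) (use A in auto)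
    also have "(\<Sum>i\<in>A. cnj (h i) * h i) = complex_of_real S"
      unfolding S_def by (simp only: of_real_sum complex_norm_square mult.commute)
    also have "S - 2 * Re (complex_of_real S) + (l2_norm I h)\<^sup>2 = (l2_norm I h)\<^sup>2 - S" by simp
    finally have lim: "(\<lambda>n. (l2_norm I (\<lambda>i. J (comb A h n) i - h i))\<^sup>2) \<longlonglongrightarrow> (l2_norm I h)\<^sup>2 - S"
      by (simp add: l2_norm_diff_power2 J_l2 h parseval)
    have "(l2_norm I h)\<^sup>2 - S < e\<^sup>2"
    proof -
      have "(l2_norm I h)\<^sup>2 - S \<le> e\<^sup>2 / 2" using A(3) unfolding dist_real_def S_def by linarith
      moreover have "0 < e\<^sup>2" using e by simp
      ultimately show ?thesis by linarith
    qed
    then obtain n where "(l2_norm I (\<lambda>i. J (comb A h n) i - h i))\<^sup>2 < e\<^sup>2"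
      using eventually_happens'[OF _ order_tendstoD(2)[OF lim]] by auto
    then have "l2_norm I (\<lambda>i. J (comb A h n) i - h i) < e"
      using e by (intro power_less_imp_less_base[of _ 2 e]) auto
    then show ?thesis by blast
  qed
  have "\<exists>x. l2_norm I (\<lambda>i. J x i - h i) < 1 / real (Suc n)" for n by (rule close) simp
  then obtain xs where xs: "\<And>n. l2_norm I (\<lambda>i. J (xs n) i - h i) < 1 / real (Suc n)" by metis
  have "(\<lambda>n. l2_norm I (\<lambda>i. J (xs n) i - h i)) \<longlonglongrightarrow> 0"
    by (rule tendsto_sandwich[OF _ _ tendsto_const LIMSEQ_inverse_real_of_nat])
      (use xs in \<open>auto intro!: always_eventually less_imp_le simp: inverse_eq_divide\<close>)
  then show thesis using h by (intro that[of xs]) (simp add: l2_conv_def J_l2)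
qed

definition bounded_form :: "('v \<Rightarrow> 'v \<Rightarrow> complex) \<Rightarrow> bool" where
  "bounded_form s \<longleftrightarrow>
     (\<forall>x y z. s (x + y) z = s x z + s y z) \<and> (\<forall>x y z. s x (y + z) = s x y + s x z)
   \<and> (\<forall>c x y. s (c *s x) y = cnj c * s x y) \<and> (\<forall>c x y. s x (c *s y) = c * s x y)
   \<and> (\<exists>C\<ge>0. \<forall>x y. cmod (s x y) \<le> C * (sqrt (sqn x) * sqrt (sqn y)))"

text \<open>The adjoint vectors \<open>t x\<close> with \<open>(t x, J y) = s x y\<close> come from the Riesz lemma, and a second
  application gives \<open>T h\<close> from \<open>(J x, T h) = (t x, h)\<close>.\<close>

lemma bounded_form_operator:
  assumes s: "bounded_form s"
  obtains T where "T \<in> bop I" "\<And>x y. l2_inner I (J x) (T (J y)) = s x y"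
proof -
  obtain C where C: "0 \<le> C" "\<And>x y. cmod (s x y) \<le> C * (sqrt (sqn x) * sqrt (sqn y))"
    using s unfolding bounded_form_def by blast
  have s_add: "s (x + y) z = s x z + s y z" "s x (y + z) = s x y + s x z" for x y z
    using s unfolding bounded_form_def by auto
  have s_scale: "s (c *s x) y = cnj c * s x y" "s x (c *s y) = c * s x y" for x y c
    using s unfolding bounded_form_def by auto
  have "\<exists>v\<in>l2 I. (\<forall>y. l2_inner I (J y) v = cnj (s x y)) \<and> l2_norm I v \<le> C * sqrt (sqn x)" for x
    by (rule riesz[of "\<lambda>y. cnj (s x y)" "C * sqrt (sqn x)"])
      (use C in \<open>auto simp: s_add s_scale mult.assoc\<close>)
  then obtain t where t: "\<And>x. t x \<in> l2 I" "\<And>x y. l2_inner I (J y) (t x) = cnj (s x y)"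
      "\<And>x. l2_norm I (t x) \<le> C * sqrt (sqn x)"
    by metis
  have t_add: "t (x + y) = (\<lambda>i. t x i + t y i)" for x y
    by (rule J_separates) (simp_all add: t l2_add l2_inner_add_right J_l2 s_add)
  have t_scale: "t (c *s x) = (\<lambda>i. c * t x i)" for c x
    by (rule J_separates) (simp_all add: t l2_scale l2_inner_scale_right J_l2 s_scale)
  have "\<exists>v\<in>l2 I. (\<forall>x. l2_inner I (J x) v = l2_inner I (t x) h) \<and> l2_norm I v \<le> C * l2_norm I h"
    if h: "h \<in> l2 I" for h
  proof (rule riesz[of "\<lambda>x. l2_inner I (t x) h" "C * l2_norm I h"])
    show "cmod (l2_inner I (t x) h) \<le> C * l2_norm I h * sqrt (sqn x)" for x
      using l2_cauchy_schwarz[OF t(1) h] mult_right_mono[OF t(3), of "l2_norm I h"]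
      by (simp add: ac_simps) (meson order_trans)
  qed (use C h t in \<open>auto simp: t_add t_scale l2_inner_add_left l2_inner_scale_left\<close>)
  then obtain T where T: "\<And>h. h \<in> l2 I \<Longrightarrow> T h \<in> l2 I"
      "\<And>h x. h \<in> l2 I \<Longrightarrow> l2_inner I (J x) (T h) = l2_inner I (t x) h"
      "\<And>h. h \<in> l2 I \<Longrightarrow> l2_norm I (T h) \<le> C * l2_norm I h"
    by metis
  \<comment> \<open>\<open>bop\<close> demands the value zero off \<open>l2 I\<close>.\<close>
  define T' where "T' h = (if h \<in> l2 I then T h else (\<lambda>_. 0))" for h
  have "T' \<in> bop I"
  proof (rule bopI[where K = C])
    fix h k assume h: "h \<in> l2 I" and k: "k \<in> l2 I"
    show "T' (\<lambda>i. h i + k i) = (\<lambda>i. T' h i + T' k i)"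
      by (rule J_separates) (simp_all add: T'_def h k T l2_add l2_inner_add_right J_l2 t)
  next
    fix h c assume h: "h \<in> l2 I"
    show "T' (\<lambda>i. c * h i) = (\<lambda>i. c * T' h i)"
      by (rule J_separates) (simp_all add: T'_def h T l2_scale l2_inner_scale_right J_l2 t)
  qed (simp_all add: T'_def T)
  moreover have "l2_inner I (J x) (T' (J y)) = s x y" for x y
    using l2_inner_cnj[of I "J y" "t x"] by (simp add: T'_def T J_l2 t)
  ultimately show thesis by (rule that)
qed

lemma bop_eqI:
  assumes S: "S \<in> bop I" and T: "T \<in> bop I"
    and eq: "\<And>x y. l2_inner I (J x) (S (J y)) = l2_inner I (J x) (T (J y))"
  shows "S = T"
proof
  fix h
  show "S h = T h"
  proof (cases "h \<in> l2 I")
    case True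
    obtain xs where xs: "l2_conv I (\<lambda>n. J (xs n)) h" using J_dense[OF True] by blast
    show ?thesis
    proof (rule J_separates)
      fix x
      note lim = l2_conv_inner[OF l2_conv_const[OF J_l2] l2_conv_bop[OF _ xs]]
      show "l2_inner I (J x) (S h) = l2_inner I (J x) (T h)"
        using LIMSEQ_unique[OF lim[OF S]] lim[OF T] by (simp add: eq)
    qed (use True S T bop_l2 in auto)
  qed (simp add: bop_outside[OF S] bop_outside[OF T])
qed

text \<open>Positivity passes from the dense range of \<open>J\<close> to limits; in the order of
  the complex numbers the imaginary part must be followed as well.\<close>

lemma op_posI:
  assumes T: "T \<in> bop I" and pos: "\<And>x. 0 \<le> l2_inner I (J x) (T (J x))"
  shows "op_pos I T"
  unfolding op_pos_def
proof (intro conjI ballI T)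
  fix h assume "h \<in> l2 I"
  then obtain xs where xs: "l2_conv I (\<lambda>n. J (xs n)) h" using J_dense by blast
  note lim = l2_conv_inner[OF xs l2_conv_bop[OF T xs]]
  have "0 \<le> Re (l2_inner I h (T h))"
    by (rule LIMSEQ_le_const[OF tendsto_Re[OF lim]]) (use pos in \<open>simp add: less_eq_complex_def\<close>)
  moreover have "Im (l2_inner I h (T h)) = 0"
    using tendsto_Im[OF lim] pos by (simp add: less_eq_complex_def LIMSEQ_const_iff)
  ultimately show "0 \<le> l2_inner I h (T h)" by (simp add: less_eq_complex_def)
qed

text \<open>For a bounded form the choice is unambiguous, by \<open>bop_eqI\<close>.\<close>

definition form_op :: "('v \<Rightarrow> 'v \<Rightarrow> complex) \<Rightarrow> 'i op" where
  "form_op s = (SOME T. T \<in> bop I \<and> (\<forall>x y. l2_inner I (J x) (T (J y)) = s x y))"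

lemma
  assumes "bounded_form s"
  shows form_op_bop: "form_op s \<in> bop I"
    and form_op_inner: "l2_inner I (J x) (form_op s (J y)) = s x y"
proof -
  have "\<exists>T. T \<in> bop I \<and> (\<forall>x y. l2_inner I (J x) (T (J y)) = s x y)"
    by (rule bounded_form_operator[OF assms]) blast
  from someI_ex[OF this, folded form_op_def]
  show "form_op s \<in> bop I" "l2_inner I (J x) (form_op s (J y)) = s x y" by blast+
qed

text \<open>Serves both maps: \<open>bop_eqI\<close> and \<open>op_posI\<close> reduce each clause
  to the same property of the forms.\<close>

lemma pos_unital_map_form_op:
  fixes \<phi> :: "'c::cstar_algebra_1 \<Rightarrow> 'v \<Rightarrow> 'v \<Rightarrow> complex"
  assumes bounded: "\<And>a. bounded_form (\<phi> a)"
    and add: "\<And>a b x y. \<phi> (a + b) x y = \<phi> a x y + \<phi> b x y"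
    and scale: "\<And>c a x y. \<phi> (scaleC c a) x y = c * \<phi> a x y"
    and pos: "\<And>a x. cpos a \<Longrightarrow> 0 \<le> \<phi> a x x" and one: "\<phi> 1 = ip"
  shows "pos_unital_map I (\<lambda>a. form_op (\<phi> a))"
proof -
  note op = form_op_bop[OF bounded] form_op_inner[OF bounded]
  show ?thesis
    unfolding pos_unital_map_def
  proof (intro conjI allI impI)
    show "form_op (\<phi> (a + b)) = form_op (\<phi> a) + form_op (\<phi> b)" for a b
      by (rule bop_eqI)
        (simp_all add: op bop_plus add, simp add: plus_fun_def l2_inner_add_right op J_l2 bop_l2[OF op(1)])
    show "form_op (\<phi> (scaleC c a)) = op_scale c (form_op (\<phi> a))" for c a
      by (rule bop_eqI)
        (simp_all add: op bop_op_scale scale,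
          simp add: op_scale_def l2_inner_scale_right op J_l2 bop_l2[OF op(1)])
    have "bounded_form ip" using bounded[of 1] by (simp add: one)
    then show "form_op (\<phi> 1) = op_id I"
      by (intro bop_eqI)
        (simp_all add: form_op_bop form_op_inner bop_op_id one, simp add: op_id_def J_l2 l2_inner_J)
    show "op_pos I (form_op (\<phi> a))" if "cpos a" for a
      using pos[OF that] by (intro op_posI) (simp_all add: op)
  qed (rule op)
qed

end

section \<open>Effects and measurement systems under positive unital maps\<close>

lemma pos_unital_map_effects:
  assumes \<nu>: "pos_unital_map I \<nu>"
  shows "\<nu> ` ceffects \<subseteq> op_effects I"
proof -
  have diff: "\<nu> (1 - x) = op_id I - \<nu> x" for x
  proof -
    have "\<nu> ((1 - x) + x) = \<nu> (1 - x) + \<nu> x" using \<nu> unfolding pos_unital_map_def by blast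
    moreover have "\<nu> 1 = op_id I" using \<nu> unfolding pos_unital_map_def by blast
    ultimately show ?thesis by simp
  qed
  have pos: "cpos a \<Longrightarrow> op_pos I (\<nu> a)" for a using \<nu> unfolding pos_unital_map_def by blast
  show ?thesis
    unfolding ceffects_def op_effects_def using pos by (auto simp flip: diff)
qed

lemma pos_unital_map_povm:
  assumes \<nu>: "pos_unital_map I \<nu>" and Q: "cpovm N Q"
  shows "op_povm I N (\<nu> \<circ> Q)"
proof -
  have add: "\<nu> (a + b) = \<nu> a + \<nu> b" for a b using \<nu> unfolding pos_unital_map_def by blast
  have "\<nu> 0 = 0" using add[of 0 0] by simp
  then have "\<nu> (\<Sum>a\<in>A. Q a) = (\<Sum>a\<in>A. \<nu> (Q a))" for A
    by (induction A rule: infinite_finite_induct) (simp_all add: add)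
  then have "(\<Sum>a\<in>{1..N}. \<nu> (Q a)) = op_id I"
    using \<nu> Q unfolding pos_unital_map_def cpovm_def by metis
  then show ?thesis
    using pos_unital_map_effects[OF \<nu>] Q unfolding op_povm_def cpovm_def by auto
qed

section \<open>Positive bilinear functionals\<close>

lemma cpos_of_real: "0 \<le> t \<Longrightarrow> cpos (of_real t :: 'a::cstar_algebra_1)"
  by (rule ccone_imp_cpos) (auto simp: ccone_def intro!: exI[of _ t])

text \<open>Polarisation: reality at \<open>x + y\<close> compares the imaginary parts, reality at
  \<open>x + sc \<i> y\<close> the real parts.\<close>

lemma sesquilinear_hermitian:
  fixes s :: "'v::ab_group_add \<Rightarrow> 'v \<Rightarrow> complex"
  assumes "\<And>x y z. s (x + y) z = s x z + s y z" "\<And>x y z. s x (y + z) = s x y + s x z"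
    and "\<And>c x y. s (sc c x) y = cnj c * s x y" "\<And>c x y. s x (sc c y) = c * s x y"
    and real: "\<And>x. Im (s x x) = 0"
  shows "cnj (s x y) = s y x"
  using real[of "x + y"] real[of "x + sc \<i> y"] real[of x] real[of y]
  by (simp add: assms(1-4) complex_eq_iff)

locale positive_bilinear =
  fixes \<omega> :: "'a::cstar_algebra_1 \<Rightarrow> 'b::cstar_algebra_1 \<Rightarrow> complex"
  assumes bil: "bilinear_functional \<omega>"
    and pos: "\<And>a b. cpos a \<Longrightarrow> cpos b \<Longrightarrow> \<omega> a b \<ge> 0"
begin

lemma \<omega>_add_left: "\<omega> (a + a') b = \<omega> a b + \<omega> a' b"
  and \<omega>_add_right: "\<omega> a (b + b') = \<omega> a b + \<omega> a b'"
  and \<omega>_scale_left: "\<omega> (scaleC c a) b = c * \<omega> a b"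
  and \<omega>_scale_right: "\<omega> a (scaleC c b) = c * \<omega> a b"
  using bil unfolding bilinear_functional_def by auto

lemma \<omega>_diff_left: "\<omega> (a - a') b = \<omega> a b - \<omega> a' b"
  using \<omega>_add_left[of "a - a'" a' b] by simp

lemma \<omega>_diff_right: "\<omega> a (b - b') = \<omega> a b - \<omega> a b'"
  using \<omega>_add_right[of a "b - b'" b'] by simp

lemma \<omega>_of_real_right: "\<omega> a (of_real t) = complex_of_real t * \<omega> a 1"
  using \<omega>_scale_right[of a "complex_of_real t" 1] by simp

text \<open>\<open>form 1\<close> is the GNS inner product; \<open>form b\<close> is the form that
  it dominates and whose operator will be \<nu>B b.\<close>

definition form :: "'b \<Rightarrow> 'a \<Rightarrow> 'a \<Rightarrow> complex" where
  "form b x y = \<omega> (cstar x * y) b"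

lemma form_add_left: "form b (x + y) z = form b x z + form b y z"
  and form_add_right: "form b x (y + z) = form b x y + form b x z"
  and form_scale_left: "form b (scaleC c x) y = cnj c * form b x y"
  and form_scale_right: "form b x (scaleC c y) = c * form b x y"
  by (simp_all add: form_def cstar_add cstar_scaleC distrib_left distrib_right \<omega>_add_left
      \<omega>_scale_left mult_scaleC_left mult_scaleC_right)

lemma form_nonneg: "cpos b \<Longrightarrow> 0 \<le> form b x x"
  by (simp add: form_def pos cpos_cstar_mult)

lemma form_semi_inner:
  assumes "cpos b"
  shows "complex_semi_inner scaleC (form b)"
proof unfold_locales
  show "cnj (form b x y) = form b y x" for x y
    by (rule sesquilinear_hermitian[where sc = scaleC])
      (use form_nonneg[OF assms] in \<open>auto simp: form_add_left form_add_right form_scale_left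
        form_scale_right less_eq_complex_def\<close>)
  show "0 \<le> Re (form b x x)" for x
    using form_nonneg[OF assms] by (simp add: less_eq_complex_def)
qed (simp_all add: form_add_right form_scale_right scaleC_add_right scaleC_add_left scaleC_scaleC scaleC_one)

sublocale gns: complex_semi_inner scaleC "form 1"
  using cpos_of_real[of 1] by (intro form_semi_inner) simp

lemma form_bound_hermitian:
  assumes "cstar b = b"
  shows "Re (form b x x) \<le> norm b * gns.sqn x"
  using pos[OF cpos_cstar_mult[of x] cpos_norm_diff[OF assms]]
  by (simp add: gns.sqn_def form_def \<omega>_diff_right \<omega>_of_real_right less_eq_complex_def)

text \<open>Cauchy-Schwarz is applied to \<open>form b\<close> itself, and each factor is then
  compared with the GNS norm.\<close>

lemma form_bound_cpos:
  assumes b: "cpos b"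
  shows "cmod (form b x y) \<le> norm b * (sqrt (gns.sqn x) * sqrt (gns.sqn y))"
proof -
  interpret b: complex_semi_inner scaleC "form b" by (rule form_semi_inner[OF b])
  have le: "sqrt (b.sqn z) \<le> sqrt (norm b) * sqrt (gns.sqn z)" for z
    using form_bound_hermitian[of b z] b by (simp add: b.sqn_def cpos_def flip: real_sqrt_mult)
  have "cmod (form b x y) \<le> sqrt (b.sqn x) * sqrt (b.sqn y)" by (rule b.cauchy_schwarz_sqrt)
  also have "\<dots> \<le> (sqrt (norm b) * sqrt (gns.sqn x)) * (sqrt (norm b) * sqrt (gns.sqn y))"
    by (intro mult_mono le) auto
  also have "\<dots> = norm b * (sqrt (gns.sqn x) * sqrt (gns.sqn y))" by simp
  finally show ?thesis .
qed

text \<open>Each hermitian part \<open>h\<close> of \<open>b\<close> is the difference of the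
  positive elements \<open>norm h\<close> and \<open>norm h - h\<close>, so the positive case
  suffices.\<close>

lemma form_bound: "\<exists>C\<ge>0. \<forall>x y. cmod (form b x y) \<le> C * (sqrt (gns.sqn x) * sqrt (gns.sqn y))"
proof -
  have hermitian: "\<exists>C\<ge>0. \<forall>x y. cmod (form h x y) \<le> C * (sqrt (gns.sqn x) * sqrt (gns.sqn y))"
    if h: "cstar h = h" for h
  proof -
    define p where "p = of_real (norm h) - h"
    define q where "q = (of_real (norm h) :: 'b)"
    have pq: "cpos p" "cpos q" "h = q - p"
      using cpos_norm_diff[OF h] by (simp_all add: p_def q_def cpos_of_real)
    have "cmod (form h x y) \<le> (norm q + norm p) * (sqrt (gns.sqn x) * sqrt (gns.sqn y))" for x y
      using form_bound_cpos[OF pq(1), of x y] form_bound_cpos[OF pq(2), of x y]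
        norm_triangle_ineq4[of "form q x y" "form p x y"]
      unfolding pq(3) by (simp add: form_def \<omega>_diff_right distrib_right)
    then show ?thesis by (intro exI[of _ "norm q + norm p"]) simp
  qed
  obtain h k where hk: "cstar h = h" "cstar k = k" "b = h + scaleC \<i> k"
    by (rule hermitian_decomposition)
  obtain C where C: "C \<ge> 0" "\<And>x y. cmod (form h x y) \<le> C * (sqrt (gns.sqn x) * sqrt (gns.sqn y))"
    using hermitian[OF hk(1)] by blast
  obtain D where D: "D \<ge> 0" "\<And>x y. cmod (form k x y) \<le> D * (sqrt (gns.sqn x) * sqrt (gns.sqn y))"
    using hermitian[OF hk(2)] by blast
  have "cmod (form b x y) \<le> (C + D) * (sqrt (gns.sqn x) * sqrt (gns.sqn y))" for x y
  proof -
    have "form b x y = form h x y + \<i> * form k x y"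
      by (simp add: form_def hk(3) \<omega>_add_right \<omega>_scale_right)
    then have "cmod (form b x y) \<le> cmod (form h x y) + cmod (form k x y)"
      using norm_triangle_ineq[of "form h x y" "\<i> * form k x y"] by (simp add: norm_mult)
    then show ?thesis using C(2)[of x y] D(2)[of x y] by (simp add: distrib_right)
  qed
  then show ?thesis using C(1) D(1) by (intro exI[of _ "C + D"]) simp
qed

text \<open>Conjugating the positive element \<open>norm c - c\<close> by \<open>y\<close> keeps it
  positive; applying \<omega> with second argument 1 gives the estimate.\<close>

lemma left_mult_bound: "gns.sqn (a * y) \<le> norm (cstar a * a) * gns.sqn y"
proof -
  define c where "c = cstar a * a"
  have c: "cstar c = c" by (simp add: c_def cstar_mult cstar_cstar)
  have "cstar y * ((of_real (norm c) - c) * y)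
      = scaleC (complex_of_real (norm c)) (cstar y * y) - cstar (a * y) * (a * y)"
    by (simp add: c_def cstar_mult algebra_simps scaleC_of_real of_real_def[where 'a = 'a])
  then have "0 \<le> \<omega> (scaleC (complex_of_real (norm c)) (cstar y * y) - cstar (a * y) * (a * y)) 1"
    using pos[OF cpos_conjugate[OF cpos_norm_diff[OF c], of y], of 1] cpos_of_real[of 1] by simp
  then show ?thesis
    by (simp add: gns.sqn_def form_def c_def \<omega>_diff_left \<omega>_scale_left less_eq_complex_def)
qed

end

theorem theorem2:
  fixes \<omega> :: "'a::cstar_algebra_1 \<Rightarrow> 'b::cstar_algebra_1 \<Rightarrow> complex"
  assumes "bilinear_functional \<omega>"
    and "\<And>a b. cpos a \<Longrightarrow> cpos b \<Longrightarrow> \<omega> a b \<ge> 0"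
    and "\<omega> 1 1 = 1"
  shows "\<exists>(I :: ('a \<times> 'b) set) \<rho> \<nu>A \<nu>B.
           bh_state I \<rho> \<and> pos_unital_map I \<nu>A \<and> pos_unital_map I \<nu>B
         \<and> (\<forall>a b. \<nu>A a \<circ> \<nu>B b = \<nu>B b \<circ> \<nu>A a)
         \<and> (\<forall>a b. \<omega> a b = \<rho> (\<nu>A a \<circ> \<nu>B b))
         \<and> \<nu>A ` ceffects \<subseteq> op_effects I \<and> \<nu>B ` ceffects \<subseteq> op_effects I
         \<and> (\<forall>N Q. cpovm N Q \<longrightarrow> op_povm I N (\<nu>A \<circ> Q))
         \<and> (\<forall>N R. cpovm N R \<longrightarrow> op_povm I N (\<nu>B \<circ> R))"
proof -
  interpret positive_bilinear \<omega> by unfold_locales (fact assms)+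
  have "surj (fst :: 'a \<times> 'b \<Rightarrow> 'a)" by (rule surjI[of _ "\<lambda>x. (x, undefined)"]) simp
  then obtain I :: "('a \<times> 'b) set" and g f where "approx_basis scaleC (form 1) I g f"
    by (rule gns.exists_approx_basis)
  then interpret H: approx_basis scaleC "form 1" I g f .
  define rep where "rep a x y = form 1 x (a * y)" for a x y
  have rep_form: "H.bounded_form (rep a)" for a
  proof -
    have "cmod (rep a x y) \<le> sqrt (norm (cstar a * a)) * (sqrt (gns.sqn x) * sqrt (gns.sqn y))" for x y
    proof -
      have "sqrt (gns.sqn (a * y)) \<le> sqrt (norm (cstar a * a)) * sqrt (gns.sqn y)"
        using left_mult_bound[of a y] by (simp flip: real_sqrt_mult)
      then have "sqrt (gns.sqn x) * sqrt (gns.sqn (a * y))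
          \<le> sqrt (gns.sqn x) * (sqrt (norm (cstar a * a)) * sqrt (gns.sqn y))"
        by (intro mult_left_mono) auto
      then show ?thesis
        using gns.cauchy_schwarz_sqrt[of x "a * y"] by (simp add: rep_def mult_ac)
    qed
    then show ?thesis
      unfolding H.bounded_form_def
      by (auto simp: rep_def form_add_left form_add_right form_scale_left form_scale_right
          distrib_left mult_scaleC_right intro!: exI[of _ "sqrt (norm (cstar a * a))"])
  qed
  have form_form: "H.bounded_form (form b)" for b
    unfolding H.bounded_form_def using form_bound[of b]
    by (auto simp: form_add_left form_add_right form_scale_left form_scale_right)
  define \<nu>A where "\<nu>A a = H.form_op (rep a)" for a
  define \<nu>B where "\<nu>B b = H.form_op (form b)" for b
  define \<rho> where "\<rho> = (\<lambda>T. l2_inner I (H.J 1) (T (H.J 1)))"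
  note opA = H.form_op_bop[OF rep_form, folded \<nu>A_def] H.form_op_inner[OF rep_form, folded \<nu>A_def]
  note opB = H.form_op_bop[OF form_form, folded \<nu>B_def] H.form_op_inner[OF form_form, folded \<nu>B_def]
  have "pos_unital_map I (\<lambda>a. H.form_op (rep a))"
  proof (rule H.pos_unital_map_form_op[OF rep_form])
    show "0 \<le> rep a x x" if "cpos a" for a x
      using pos[OF cpos_conjugate[OF that, of x], of 1] cpos_of_real[of 1]
      by (simp add: rep_def form_def)
  qed (auto simp: fun_eq_iff rep_def form_def algebra_simps mult_scaleC_left mult_scaleC_right \<omega>_add_left \<omega>_scale_left)
  then have A: "pos_unital_map I \<nu>A" by (simp add: \<nu>A_def[abs_def])
  have "pos_unital_map I (\<lambda>b. H.form_op (form b))"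
    by (rule H.pos_unital_map_form_op[OF form_form])
      (auto simp: form_nonneg, simp_all add: form_def \<omega>_add_right \<omega>_scale_right)
  then have B: "pos_unital_map I \<nu>B" by (simp add: \<nu>B_def[abs_def])
  have A_J: "\<nu>A a (H.J y) = H.J (a * y)" for a y
    by (rule H.J_separates)
      (simp_all add: opA H.J_l2 bop_l2[OF opA(1)] H.l2_inner_J, simp add: rep_def)
  \<comment> \<open>\<nu>B may take \<open>H.J y\<close> out of the range of \<open>H.J\<close>,
    where \<nu>A is no longer given by multiplication. The adjoint relation is therefore extended by
    density to all of \<open>l2 I\<close>.\<close>
  have A_adjoint: "l2_inner I (H.J x) (\<nu>A a h) = l2_inner I (H.J (cstar a * x)) h"
    if h: "h \<in> l2 I" for a x h
  proof -
    obtain xs where xs: "l2_conv I (\<lambda>n. H.J (xs n)) h" using H.J_dense[OF h] by blast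
    have "l2_inner I (H.J x) (\<nu>A a (H.J y)) = l2_inner I (H.J (cstar a * x)) (H.J y)" for y
      by (simp add: A_J H.l2_inner_J form_def cstar_mult cstar_cstar mult.assoc)
    then show ?thesis
      using LIMSEQ_unique[OF l2_conv_inner[OF l2_conv_const[OF H.J_l2] l2_conv_bop[OF opA(1) xs]]]
        l2_conv_inner[OF l2_conv_const[OF H.J_l2] xs] by simp
  qed
  \<comment> \<open>Both sides have the matrix coefficient
    \<open>\<omega> (cstar x * a * y) b\<close>.\<close>
  have commute: "\<nu>A a \<circ> \<nu>B b = \<nu>B b \<circ> \<nu>A a" for a b
  proof (rule H.bop_eqI)
    show "l2_inner I (H.J x) ((\<nu>A a \<circ> \<nu>B b) (H.J y)) = l2_inner I (H.J x) ((\<nu>B b \<circ> \<nu>A a) (H.J y))"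
      for x y
      by (simp add: A_adjoint bop_l2[OF opB(1)] H.J_l2 A_J opB)
        (simp add: form_def cstar_mult cstar_cstar mult.assoc)
  qed (intro bop_comp opA opB)+
  \<comment> \<open>\<open>\<omega> 1 1 = 1\<close> is the normalisation of the cyclic
    vector.\<close>
  have "l2_norm I (H.J 1) = 1" by (simp add: H.l2_norm_J_eq gns.sqn_def form_def assms(3))
  then have \<rho>: "bh_state I \<rho>" unfolding \<rho>_def by (intro vector_state H.J_l2)
  \<comment> \<open>Swapping the factors lets \<nu>A act first, on \<open>H.J 1\<close>, where it is
    multiplication; what remains is \<open>form b 1 a\<close>.\<close>
  have \<omega>: "\<omega> a b = \<rho> (\<nu>A a \<circ> \<nu>B b)" for a b
    unfolding commute by (simp add: \<rho>_def A_J opB) (simp add: form_def)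
  show ?thesis
    by (intro exI[of _ I] exI[of _ \<rho>] exI[of _ \<nu>A] exI[of _ \<nu>B] conjI allI impI)
      (fact \<rho> A B commute \<omega> pos_unital_map_effects[OF A] pos_unital_map_effects[OF B]
        pos_unital_map_povm[OF A] pos_unital_map_povm[OF B])+
qed

end
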